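(* Let $R$ be a finite local commutative ring, $K\le R^\times$ a pure group, $\mathcal C=\mathrm{Cyc}(K,R)$, $I_0=\{x\in\mathrm{rad}(R):\ x\,\mathrm{rad}(R)=\{0\}\}$, $\pi_0:R\to R/I_0$ the natural epimorphism, and $\mathcal C'=\mathrm{Cyc}(\pi_0(K),R/I_0)$. Then $\mathcal C$ is normal whenever $\mathcal C'$ is normal.
   Context: All rings have an identity. For a finite local commutative ring $R$, $\mathrm{rad}(R)$ is its unique maximal ideal. For a subgroup $K$ of $R^\times$, the cyclotomic scheme $\mathrm{Cyc}(K,R)$ is the pair $(R,\mathrm{Rel}(K,R))$, where $\mathrm{Rel}(K,R)$ is the set of binary relations $\{(x,y)\in R\times R:\ y-x\in rK\}$, $r\in R$. Its automorphism group $\mathrm{Aut}(\mathcal C)$ is the group of permutations $f$ of $R$ with $S^f=S$ for all $S\in\mathrm{Rel}(K,R)$. $\mathrm{A\Gamma L}_1(R)$ is the group of permutations $x\mapsto ax^\sigma+b$ with $a\in R^\times$, $b\in R$, $\sigma\in\mathrm{Aut}(R)$; the scheme is normal if $\mathrm{Aut}(\mathcal C)\le\mathrm{A\Gamma L}_1(R)$. A group $K\le R^\times$ is pure if the only ideal $I$ of $R$ with $1+I\subseteq K$ is $I=\{0\}$. Note $\pi_0(K)\le (R/I_0)^\times$. *)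

theory Defs
  imports "HOL-Algebra.Algebra"
begin

definition local_ring :: "('a, 'b) ring_scheme \<Rightarrow> bool" where
  "local_ring R \<longleftrightarrow> cring R \<and> (\<exists>!I. maximalideal I R)"

definition rad :: "('a, 'b) ring_scheme \<Rightarrow> 'a set" where
  "rad R = (THE I. maximalideal I R)"

definition I0 :: "('a, 'b) ring_scheme \<Rightarrow> 'a set" where
  "I0 R = {x \<in> rad R. (\<lambda>y. x \<otimes>\<^bsub>R\<^esub> y) ` rad R = {\<zero>\<^bsub>R\<^esub>}}"

definition pure_group :: "('a, 'b) ring_scheme \<Rightarrow> 'a set \<Rightarrow> bool" where
  "pure_group R K \<longleftrightarrow>
     (\<forall>I. ideal I R \<and> (\<lambda>x. \<one>\<^bsub>R\<^esub> \<oplus>\<^bsub>R\<^esub> x) ` I \<subseteq> K \<longrightarrow> I = {\<zero>\<^bsub>R\<^esub>})"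

definition cyc_rels :: "('a, 'b) ring_scheme \<Rightarrow> 'a set \<Rightarrow> ('a \<times> 'a) set set" where
  "cyc_rels R K =
     (\<lambda>r. {(x, y). x \<in> carrier R \<and> y \<in> carrier R \<and>
                   y \<ominus>\<^bsub>R\<^esub> x \<in> (\<lambda>k. r \<otimes>\<^bsub>R\<^esub> k) ` K}) ` carrier R"

definition cyc_aut :: "('a, 'b) ring_scheme \<Rightarrow> 'a set \<Rightarrow> ('a \<Rightarrow> 'a) set" where
  "cyc_aut R K =
     {f. bij_betw f (carrier R) (carrier R) \<and>
         (\<forall>S \<in> cyc_rels R K. (\<lambda>(x, y). (f x, f y)) ` S = S)}"

definition AGammaL1 :: "('a, 'b) ring_scheme \<Rightarrow> ('a \<Rightarrow> 'a) set" where
  "AGammaL1 R =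
     {f. \<exists>a \<in> Units R. \<exists>b \<in> carrier R. \<exists>\<sigma> \<in> ring_iso R R.
           \<forall>x \<in> carrier R. f x = a \<otimes>\<^bsub>R\<^esub> \<sigma> x \<oplus>\<^bsub>R\<^esub> b}"

text \<open>Cyc(K,R) is normal iff Aut(Cyc(K,R)) \<le> A Gamma L_1(R)
  (equality of permutations is taken on the carrier).\<close>
definition cyc_normal :: "('a, 'b) ring_scheme \<Rightarrow> 'a set \<Rightarrow> bool" where
  "cyc_normal R K \<longleftrightarrow>
     (\<forall>f \<in> cyc_aut R K. \<exists>g \<in> AGammaL1 R. \<forall>x \<in> carrier R. f x = g x)"

end

theory Submission
  imports Defs
begin

text \<open>
  Let \<open>M\<close> be the maximal ideal, \<open>I = I0 R\<close> and \<open>J = {j \<in> I. 1 + j \<in> K}\<close>. As \<open>I M = 0\<close>, \<open>J\<close> is an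
  additive group, and purity of \<open>K\<close> says that \<open>J\<close> contains no nonzero ideal. If two automorphisms
  \<open>f\<close>, \<open>g\<close> of the scheme fix \<open>0\<close> and agree modulo \<open>I\<close>, then \<open>d x = f\<inverse> (g x) - x\<close> is \<open>I\<close>-valued and
  \<open>d x - d y \<in> (x - y) J\<close> whenever \<open>x - y\<close> is a unit. The heart of the proof is that such a map is
  affine, \<open>d x = d 0 + x j\<close> with \<open>j \<in> J\<close>; so \<open>g x = f (x + x j)\<close>.

  An automorphism can be normalized to fix \<open>0\<close> and \<open>1\<close>; normality of the quotient scheme then makes
  it a ring automorphism modulo \<open>I\<close>. Hence the above applies to \<open>g x = f (x + y) - f y\<close> and to
  \<open>g x = (f u)\<inverse> f (u x)\<close> for units \<open>u\<close>. In both cases \<open>j = 0\<close>, in the first one by the symmetry of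
  \<open>f (x + y)\<close> in \<open>x\<close>, \<open>y\<close> and purity, so \<open>f\<close> is a ring automorphism.
\<close>

subsection \<open>Finite local rings\<close>

lemma (in abelian_group) minus_eq_iff:
  "\<lbrakk>a \<in> carrier G; b \<in> carrier G; c \<in> carrier G\<rbrakk> \<Longrightarrow> a \<ominus> b = c \<longleftrightarrow> a = c \<oplus> b"
  by (metis a_assoc a_closed a_inv_closed a_minus_def l_neg r_zero r_neg)

lemma (in abelian_group) eq_minus_iff:
  "\<lbrakk>a \<in> carrier G; b \<in> carrier G; c \<in> carrier G\<rbrakk> \<Longrightarrow> c = a \<ominus> b \<longleftrightarrow> c \<oplus> b = a"
  by (metis minus_eq_iff)

lemma (in abelian_group) add_minus_cancel:
  "\<lbrakk>a \<in> carrier G; b \<in> carrier G\<rbrakk> \<Longrightarrow> a \<oplus> (b \<oplus> \<ominus> a) = b"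
  "\<lbrakk>a \<in> carrier G; b \<in> carrier G\<rbrakk> \<Longrightarrow> a \<oplus> (b \<ominus> a) = b"
  by (metis a_inv_closed a_lcomm minus_eq r_neg r_zero)+

lemma (in monoid) Units_cancel:
  "\<lbrakk>u \<in> Units G; v \<in> carrier G\<rbrakk> \<Longrightarrow> u \<otimes> (inv u \<otimes> v) = v"
  "\<lbrakk>u \<in> Units G; v \<in> carrier G\<rbrakk> \<Longrightarrow> inv u \<otimes> (u \<otimes> v) = v"
  by (simp_all add: Units_closed m_assoc[symmetric])

lemma (in comm_monoid) Units_inv_mult:
  "\<lbrakk>u \<in> Units G; v \<in> Units G\<rbrakk> \<Longrightarrow> inv (u \<otimes> v) = inv u \<otimes> inv v"
  by (rule comm_inv_char) (simp_all add: Units_closed m_assoc m_lcomm[of v] Units_cancel)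

text \<open>For \<open>a\<close> outside \<open>A\<close> and \<open>b\<close> outside
  \<open>B\<close>, one has \<open>a\<close> in \<open>B\<close> and \<open>b\<close> in
  \<open>A\<close>. If \<open>a + b\<close> lay in \<open>A\<close>, then so would \<open>a\<close>;
  if it lay in \<open>B\<close>, then so would \<open>b\<close>.\<close>

lemma (in abelian_group) additive_subgroup_Un:
  assumes "additive_subgroup A G" "additive_subgroup B G" "carrier G \<subseteq> A \<union> B"
  shows "carrier G \<subseteq> A \<or> carrier G \<subseteq> B"
proof (rule ccontr)
  assume "\<not> ?thesis"
  then obtain a b where ab: "a \<in> carrier G" "a \<notin> A" "b \<in> carrier G" "b \<notin> B" by blast
  then have mem: "a \<in> B" "b \<in> A" using assms(3) by auto
  interpret A: additive_subgroup A G by fact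
  interpret B: additive_subgroup B G by fact
  have "a \<oplus> b \<in> A \<or> a \<oplus> b \<in> B" using ab assms(3) by blast
  moreover have "a = (a \<oplus> b) \<oplus> \<ominus> b" "b = \<ominus> a \<oplus> (a \<oplus> b)"
    using ab by (simp_all add: a_assoc r_neg r_neg1)
  ultimately show False
    using mem ab A.a_closed B.a_closed A.a_inv_closed B.a_inv_closed by metis
qed

text \<open>In a finite group the negative of \<open>a\<close> is its multiple by
  \<open>order G - 1\<close>, so closure under addition already yields negatives.\<close>

lemma (in abelian_group) additive_subgroup_finiteI:
  assumes "finite (carrier G)" "H \<subseteq> carrier G" "\<zero> \<in> H"
    "\<And>a b. a \<in> H \<Longrightarrow> b \<in> H \<Longrightarrow> a \<oplus> b \<in> H"
  shows "additive_subgroup H G"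
proof -
  have "subgroup H (add_monoid G)"
  proof (rule add.subgroupI)
    fix a assume a: "a \<in> H"
    have pow: "add_pow G n a \<in> H" for n :: nat
      by (induction n) (use a assms in \<open>auto simp: add.nat_pow_Suc\<close>)
    have "a \<in> carrier G" using a assms by blast
    then have "add_pow G (order G) a = \<zero>"
      using add.pow_order_eq_1 by (simp add: order_def)
    moreover have "order G > 0" using assms(1) \<open>a \<in> carrier G\<close>
      by (auto simp: order_def card_gt_0_iff)
    ultimately have "add_pow G (order G - 1) a \<oplus> a = \<zero>"
      by (metis Suc_diff_1 add.nat_pow_Suc)
    then have "\<ominus> a = add_pow G (order G - 1) a"
      using \<open>a \<in> carrier G\<close> by (metis add.nat_pow_closed minus_equality)
    then show "\<ominus> a \<in> H" using pow by simp
  qed (use assms in auto)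
  then show ?thesis by (simp add: additive_subgroup_def)
qed

text \<open>By Lagrange the index of \<open>H\<close> is below \<open>2\<close>, and it is not
  \<open>0\<close>.\<close>

lemma (in abelian_group) additive_subgroup_eq_carrier:
  assumes "finite (carrier G)" "additive_subgroup H G" "card (carrier G) < 2 * card H"
  shows "H = carrier G"
proof -
  interpret additive_subgroup H G by fact
  have "card (a_rcosets H) * card H = order G"
    using a_lagrange[OF _ assms(2)] assms(1) by simp
  with assms(3) have "card (a_rcosets H) * card H < 2 * card H" by (simp add: order_def)
  then have "card (a_rcosets H) < 2" by simp
  moreover have "order G \<noteq> 0"
    using assms(1) a_subset zero_closed by (auto simp: order_def)
  then have "card (a_rcosets H) \<noteq> 0"
    using \<open>card (a_rcosets H) * card H = order G\<close> by (metis mult_0)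
  ultimately have "card (a_rcosets H) = 1" by linarith
  then have "card H = card (carrier G)"
    using \<open>card (a_rcosets H) * card H = order G\<close> by (simp add: order_def)
  then show ?thesis using assms(1) a_subset by (simp add: card_subset_eq)
qed

lemma (in abelian_group) card_proper_additive_subgroup:
  assumes "finite (carrier G)" "additive_subgroup H G" "H \<noteq> carrier G"
  shows "2 * card H \<le> card (carrier G)"
  using additive_subgroup_eq_carrier[OF assms(1,2)] assms(3) by linarith

section \<open>Units and the residue field of a finite local ring\<close>

locale finite_local_ring = cring R for R (structure) +
  fixes M
  assumes finite_carrier: "finite (carrier R)"
    and maximal: "maximalideal M R"
    and Units_eq: "Units R = carrier R - M"
begin

sublocale M: maximalideal M R by (rule maximal)

lemma Units_add_M:
  assumes "u \<in> Units R" "x \<in> M" shows "u \<oplus> x \<in> Units R"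
proof -
  have "u \<in> carrier R" "x \<in> carrier R" "u \<notin> M" using assms Units_eq M.Icarr by auto
  moreover have "u = (u \<oplus> x) \<oplus> \<ominus> x" using calculation by (simp add: a_assoc r_neg)
  ultimately show ?thesis using assms(2) Units_eq
    by (metis DiffI M.a_closed M.a_inv_closed a_closed)
qed

text \<open>The number \<open>n\<close> is one less than the order of the residue field.\<close>

lemma residue_exponent:
  obtains n :: nat where "\<And>u. u \<in> Units R \<Longrightarrow> u [^] n \<ominus> \<one> \<in> M" "add_pow R (Suc n) \<one> \<in> M"
proof -
  let ?F = "R Quot M"
  interpret F: field ?F using M.quotient_is_field[OF is_cring] .
  have cF: "carrier ?F = (\<lambda>x. M +> x) ` carrier R"
    by (auto simp: FactRing_def A_RCOSETS_def')
  have fin: "finite (carrier ?F)" using cF finite_carrier by simp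
  interpret h: ring_hom_ring R ?F "(+>) M" by (rule M.rcos_ring_hom_ring)
  interpret G: group "units_of ?F" by (rule F.units_group)
  define n where "n = card (carrier ?F) - 1"
  have card: "card (carrier ?F) = Suc n"
    using fin F.zero_closed by (metis Suc_diff_1 card_gt_0_iff empty_iff n_def)
  have zero: "x \<in> M" if "x \<in> carrier R" "M +> x = \<zero>\<^bsub>?F\<^esub>" for x
  proof -
    have "\<zero>\<^bsub>?F\<^esub> = M" unfolding FactRing_def by simp
    then show ?thesis using that M.a_rcos_self[OF that(1)] by metis
  qed
  have 1: "u [^] n \<ominus> \<one> \<in> M" if u: "u \<in> Units R" for u
  proof -
    have uc: "u \<in> carrier R" "u \<notin> M" using u Units_eq by auto
    then have c: "M +> u \<in> carrier (units_of ?F)"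
      using zero h.hom_closed unfolding units_of_carrier F.field_Units by blast
    have "order (units_of ?F) = n"
      using fin F.zero_closed by (simp add: order_def units_of_carrier F.field_Units card)
    then have "(M +> u) [^]\<^bsub>units_of ?F\<^esub> n = \<one>\<^bsub>?F\<^esub>"
      using G.pow_order_eq_1[OF c] by (simp add: units_of_one)
    then have "(M +> u) [^]\<^bsub>?F\<^esub> n = \<one>\<^bsub>?F\<^esub>" 
      using c by (simp add: F.units_of_pow units_of_carrier)
    then have "M +> (u [^] n) = M +> \<one>"
      using uc h.hom_nat_pow[of u n] by simp
    then show ?thesis using uc by (simp add: quotient_eq_iff_same_a_r_cos[OF M.is_ideal])
  qed
  have "add_pow ?F (Suc n) \<one>\<^bsub>?F\<^esub> = \<zero>\<^bsub>?F\<^esub>"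
    using F.add.pow_order_eq_1[OF F.one_closed] card by (simp add: order_def)
  moreover have hp: "M +> add_pow R k \<one> = add_pow ?F k \<one>\<^bsub>?F\<^esub>" for k :: nat
    by (induction k) (simp_all add: add.nat_pow_Suc F.add.nat_pow_Suc)
  ultimately have "add_pow R (Suc n) \<one> \<in> M" by (intro zero) (simp_all only: hp, simp)
  with 1 show ?thesis using that by blast
qed

end

subsection \<open>Maps with slopes in a group without ideals\<close>

text \<open>By \<open>I_M\<close>, the ideal \<open>I\<close> is a vector space over the residue
  field. The assumption \<open>pure\<close> says that \<open>J\<close> contains no nonzero ideal,
  tested on principal ideals.\<close>

locale slope_system = finite_local_ring +
  fixes I J
  assumes I_ideal: "ideal I R"
    and I_M: "\<lbrakk>v \<in> I; x \<in> M\<rbrakk> \<Longrightarrow> x \<otimes> v = \<zero>"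
    and J_additive_subgroup: "additive_subgroup J R"
    and J_subset: "J \<subseteq> I"
    and pure: "\<lbrakk>v \<in> I; \<And>r. r \<in> carrier R \<Longrightarrow> r \<otimes> v \<in> J\<rbrakk> \<Longrightarrow> v = \<zero>"
begin

sublocale I: ideal I R by (rule I_ideal)
sublocale J: additive_subgroup J R by (rule J_additive_subgroup)

lemma I_minus [simp]: "\<lbrakk>v \<in> I; w \<in> I\<rbrakk> \<Longrightarrow> v \<ominus> w \<in> I"
  by (simp add: minus_eq)

lemma J_minus: "\<lbrakk>v \<in> J; w \<in> J\<rbrakk> \<Longrightarrow> v \<ominus> w \<in> J"
  by (simp add: minus_eq)

lemma Units_or_M: "x \<in> carrier R \<Longrightarrow> x \<in> Units R \<or> x \<in> M"
  using Units_eq by blast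

text \<open>\<open>M\<close> annihilates \<open>I\<close>, so only the class of a scalar modulo
  \<open>M\<close> matters.\<close>

lemma mult_I_cong:
  assumes "a \<in> carrier R" "b \<in> carrier R" "a \<ominus> b \<in> M" "v \<in> I"
  shows "a \<otimes> v = b \<otimes> v"
proof -
  have "(a \<ominus> b) \<otimes> v = \<zero>" using assms I_M by blast
  then have "a \<otimes> v \<ominus> b \<otimes> v = \<zero>"
    using assms by (simp add: minus_eq l_distr l_minus)
  then show ?thesis using assms by (simp add: minus_eq_iff)
qed

text \<open>Congruent units act equally on \<open>I\<close>, hence so do their inverses. This
  compares slopes whose denominators are congruent modulo \<open>M\<close>.\<close>

lemma inv_mult_I_cong:
  assumes "a \<in> Units R" "b \<in> Units R" "a \<ominus> b \<in> M" "v \<in> I"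
  shows "inv a \<otimes> v = inv b \<otimes> v"
proof -
  have "a \<otimes> (inv b \<otimes> v) = b \<otimes> (inv b \<otimes> v)"
    using assms by (intro mult_I_cong) (auto intro: I.I_l_closed)
  also have "\<dots> = v" using assms by (simp add: Units_cancel)
  finally have "inv a \<otimes> (a \<otimes> (inv b \<otimes> v)) = inv a \<otimes> v" by simp
  then show ?thesis using assms by (simp add: Units_cancel)
qed

text \<open>Scalars in \<open>M\<close> kill \<open>v\<close>, so the test in \<open>pure\<close>
  reduces to units.\<close>

lemma zero_if_Units_mult_in_J:
  assumes "v \<in> I" "\<And>u. u \<in> Units R \<Longrightarrow> u \<otimes> v \<in> J"
  shows "v = \<zero>"
  using assms Units_or_M I_M by (metis pure J.zero_closed)

text \<open>A difference quotient exists only for a unit denominator; arguments congruent modulo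
  \<open>M\<close> are treated in \<open>slope_map_cong\<close>.\<close>

definition slope_map :: "('a \<Rightarrow> 'a) \<Rightarrow> bool" where
  "slope_map d \<longleftrightarrow> d \<in> carrier R \<rightarrow> I \<and>
     (\<forall>x \<in> carrier R. \<forall>y \<in> carrier R. x \<ominus> y \<in> Units R \<longrightarrow> inv (x \<ominus> y) \<otimes> (d x \<ominus> d y) \<in> J)"

lemma slope_map_I: "slope_map d \<Longrightarrow> x \<in> carrier R \<Longrightarrow> d x \<in> I"
  by (auto simp: slope_map_def)

text \<open>Given a unit \<open>u\<close>, choose \<open>z\<close> with
  \<open>x - z = inv u\<close>. Then \<open>y - z\<close> is congruent to \<open>inv u\<close>
  modulo \<open>M\<close>, so the slopes of \<open>d\<close> from \<open>z\<close> to
  \<open>x\<close> and from \<open>z\<close> to \<open>y\<close> are both \<open>u\<close> times the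
  difference of values. Subtracting them puts \<open>u (d x - d y)\<close> into \<open>J\<close> for
  every unit \<open>u\<close>.\<close>

lemma slope_map_cong:
  assumes d: "slope_map d" and x: "x \<in> carrier R" and y: "y \<in> carrier R" and M: "x \<ominus> y \<in> M"
  shows "d x = d y"
proof -
  have dI: "\<And>x. x \<in> carrier R \<Longrightarrow> d x \<in> I" using d slope_map_I by blast
  have "d x \<ominus> d y = \<zero>"
  proof (rule zero_if_Units_mult_in_J)
    fix u assume u: "u \<in> Units R"
    define z where "z = x \<ominus> inv u"
    have z: "z \<in> carrier R" using x u by (simp add: z_def)
    have xz: "x \<ominus> z = inv u" using x u by (simp add: z_def minus_eq minus_add a_ac add_minus_cancel)
    have yz: "y \<ominus> z = inv u \<oplus> \<ominus> (x \<ominus> y)"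
      using x y u by (simp add: z_def minus_eq minus_add a_ac)
    have yzU: "y \<ominus> z \<in> Units R"
      unfolding yz using Units_add_M u M by simp
    have "(y \<ominus> z) \<ominus> inv u = \<ominus> (x \<ominus> y)"
      unfolding yz using x y u by (simp add: minus_eq minus_add a_ac add_minus_cancel)
    then have cong: "(y \<ominus> z) \<ominus> inv u \<in> M" using M by simp
    have 1: "u \<otimes> (d x \<ominus> d z) \<in> J"
      using d x z xz u unfolding slope_map_def by (metis Units_inv_Units Units_inv_inv)
    have "inv (y \<ominus> z) \<otimes> (d y \<ominus> d z) \<in> J"
      using d y z yzU unfolding slope_map_def by blast
    then have 2: "u \<otimes> (d y \<ominus> d z) \<in> J"
      using inv_mult_I_cong[OF yzU Units_inv_Units[OF u] cong] dI y z u by simp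
    have "u \<otimes> (d x \<ominus> d y) = u \<otimes> (d x \<ominus> d z) \<ominus> u \<otimes> (d y \<ominus> d z)"
      using I.Icarr[OF dI] x y z u Units_closed[OF u]
      by (simp add: minus_eq minus_add r_distr r_minus a_ac r_neg1 r_neg2 add_minus_cancel)
    then show "u \<otimes> (d x \<ominus> d y) \<in> J" using J_minus[OF 1 2] by simp
  qed (use dI x y in auto)
  then show ?thesis using dI x y I.Icarr by (simp add: minus_eq_iff)
qed

section \<open>Additive slope maps and the action of the units on them\<close>

definition additive_slope_map :: "('a \<Rightarrow> 'a) \<Rightarrow> bool" where
  "additive_slope_map d \<longleftrightarrow> d \<in> carrier R \<rightarrow>\<^sub>E I \<and>
     (\<forall>x \<in> carrier R. \<forall>y \<in> carrier R. d (x \<oplus> y) = d x \<oplus> d y) \<and>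
     (\<forall>x \<in> M. d x = \<zero>) \<and> (\<forall>u \<in> Units R. inv u \<otimes> d u \<in> J)"

text \<open>Conjugation by the multiplication with \<open>c\<close>. Maps fixed by all twists
  commute with multiplication by units.\<close>

definition twist :: "'a \<Rightarrow> ('a \<Rightarrow> 'a) \<Rightarrow> 'a \<Rightarrow> 'a" where
  "twist c d = (\<lambda>x \<in> carrier R. inv c \<otimes> d (c \<otimes> x))"

definition diff :: "('a \<Rightarrow> 'a) \<Rightarrow> ('a \<Rightarrow> 'a) \<Rightarrow> 'a \<Rightarrow> 'a" where
  "diff d e = (\<lambda>x \<in> carrier R. d x \<ominus> e x)"

text \<open>Being nonempty and closed under \<open>diff\<close>, such a set is a group under
  pointwise addition.\<close>

definition twist_stable :: "('a \<Rightarrow> 'a) set \<Rightarrow> bool" where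
  "twist_stable N \<longleftrightarrow> N \<noteq> {} \<and> N \<subseteq> Collect additive_slope_map \<and>
     (\<forall>d \<in> N. \<forall>e \<in> N. diff d e \<in> N) \<and> (\<forall>c \<in> Units R. \<forall>d \<in> N. twist c d \<in> N)"

lemma additive_slope_mapD:
  assumes "additive_slope_map d"
  shows "\<And>x. x \<in> carrier R \<Longrightarrow> d x \<in> I" "\<And>x. x \<in> carrier R \<Longrightarrow> d x \<in> carrier R"
    "\<And>x y. x \<in> carrier R \<Longrightarrow> y \<in> carrier R \<Longrightarrow> d (x \<oplus> y) = d x \<oplus> d y"
    "\<And>x. x \<in> M \<Longrightarrow> d x = \<zero>" "\<And>u. u \<in> Units R \<Longrightarrow> inv u \<otimes> d u \<in> J"
    "d \<in> extensional (carrier R)"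
  using assms by (auto simp: additive_slope_map_def PiE_def dest: I.Icarr funcset_mem)

lemma additive_slope_map_cong:
  assumes "additive_slope_map d" "x \<in> carrier R" "y \<in> carrier R" "x \<ominus> y \<in> M"
  shows "d x = d y"
proof -
  have "x = y \<oplus> (x \<ominus> y)" using assms by (simp add: add_minus_cancel)
  then have "d x = d y \<oplus> d (x \<ominus> y)" using additive_slope_mapD(3)[OF assms(1)] assms
    by (metis minus_closed)
  then show ?thesis using additive_slope_mapD(2,4)[OF assms(1)] assms by simp
qed

lemma additive_slope_map_diff:
  assumes d: "additive_slope_map d" and e: "additive_slope_map e"
  shows "additive_slope_map (diff d e)"
  unfolding additive_slope_map_def diff_def
proof (intro conjI ballI)
  note [simp] = additive_slope_mapD[OF d] additive_slope_mapD[OF e]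
  show "(\<lambda>x\<in>carrier R. d x \<ominus> e x) \<in> carrier R \<rightarrow>\<^sub>E I" by simp
  show "(\<lambda>x\<in>carrier R. d x \<ominus> e x) x = \<zero>" if "x \<in> M" for x
    using that M.Icarr by (simp add: minus_eq)
  show "(\<lambda>x\<in>carrier R. d x \<ominus> e x) (x \<oplus> y)
      = (\<lambda>x\<in>carrier R. d x \<ominus> e x) x \<oplus> (\<lambda>x\<in>carrier R. d x \<ominus> e x) y"
    if "x \<in> carrier R" "y \<in> carrier R" for x y
    using that by (simp add: minus_eq minus_add a_ac)
  show "inv u \<otimes> (\<lambda>x\<in>carrier R. d x \<ominus> e x) u \<in> J" if "u \<in> Units R" for u
  proof -
    have "inv u \<otimes> (d u \<ominus> e u) = inv u \<otimes> d u \<ominus> inv u \<otimes> e u"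
      using that Units_closed[OF that] by (simp add: minus_eq r_distr r_minus)
    then show ?thesis using that Units_closed[OF that] J_minus by simp
  qed
qed

text \<open>The slope of \<open>twist c d\<close> at \<open>u\<close> is the slope of
  \<open>d\<close> at \<open>c u\<close>.\<close>

lemma additive_slope_map_twist:
  assumes d: "additive_slope_map d" and c: "c \<in> Units R"
  shows "additive_slope_map (twist c d)"
  unfolding additive_slope_map_def twist_def
proof (intro conjI ballI)
  note [simp] = additive_slope_mapD[OF d]
  show "(\<lambda>x\<in>carrier R. inv c \<otimes> d (c \<otimes> x)) \<in> carrier R \<rightarrow>\<^sub>E I"
    using c by (auto intro!: I.I_l_closed)
  show "(\<lambda>x\<in>carrier R. inv c \<otimes> d (c \<otimes> x)) x = \<zero>" if "x \<in> M" for x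
    using that M.Icarr M.I_l_closed[OF that Units_closed[OF c]] c by simp
  show "(\<lambda>x\<in>carrier R. inv c \<otimes> d (c \<otimes> x)) (x \<oplus> y)
      = (\<lambda>x\<in>carrier R. inv c \<otimes> d (c \<otimes> x)) x \<oplus> (\<lambda>x\<in>carrier R. inv c \<otimes> d (c \<otimes> x)) y"
    if "x \<in> carrier R" "y \<in> carrier R" for x y
    using that c Units_closed[OF c] by (simp add: r_distr)
  show "inv u \<otimes> (\<lambda>x\<in>carrier R. inv c \<otimes> d (c \<otimes> x)) u \<in> J" if "u \<in> Units R" for u
  proof -
    have "inv u \<otimes> (inv c \<otimes> d (c \<otimes> u)) = inv (c \<otimes> u) \<otimes> d (c \<otimes> u)"
      using that c Units_closed[OF that] Units_closed[OF c] by (simp add: Units_inv_mult m_ac)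
    then show ?thesis using that Units_closed[OF that] c by simp
  qed
qed


text \<open>Write \<open>T c\<close> for \<open>twist c\<close>. Additivity of the maps gives \<open>c (T (c + 1) - T c) = 1 - T (c + 1)\<close>.
  By induction on \<open>N\<close>, the operator \<open>T (c + 1) - T c\<close> is either onto, and then \<open>N\<close> is closed
  under multiplication by \<open>c\<close>, or has linear values, and then \<open>T (c + 1)\<close> is unipotent of order
  prime to the residue characteristic, so that \<open>T c\<close> is the identity on \<open>N\<close>. Both alternatives
  define additive subgroups of \<open>R\<close>, hence one of them holds for all \<open>c\<close>; if it is the first,
  purity forces \<open>N\<close> to be zero.\<close>

lemma twist_stable_linear:
  assumes "finite N" "twist_stable N"
  shows "\<forall>d \<in> N. \<forall>c \<in> carrier R. \<forall>x \<in> carrier R. d (c \<otimes> x) = c \<otimes> d x"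
  using assms
proof (induction N rule: finite_psubset_induct)
  case (psubset N)
  have asm: "\<And>d. d \<in> N \<Longrightarrow> additive_slope_map d"
    and diffN: "\<And>d e. d \<in> N \<Longrightarrow> e \<in> N \<Longrightarrow> diff d e \<in> N"
    and twistN: "\<And>c d. c \<in> Units R \<Longrightarrow> d \<in> N \<Longrightarrow> twist c d \<in> N"
    and ne: "N \<noteq> {}"
    using psubset.prems by (auto simp: twist_stable_def)
  note D = additive_slope_mapD[OF asm]
  have zeroN: "(\<lambda>x\<in>carrier R. \<zero>) \<in> N"
  proof -
    obtain d where d: "d \<in> N" using ne by blast
    have "diff d d = (\<lambda>x\<in>carrier R. \<zero>)"
      using D[OF d] by (auto simp: diff_def fun_eq_iff minus_eq r_neg)
    then show ?thesis using diffN[OF d d] by simp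
  qed
  \<comment> \<open>\<open>P\<close> holds the scalars of the first alternative, \<open>Q\<close>
    those of the second.\<close>
  define P where "P = {c \<in> carrier R. \<forall>d \<in> N. (\<lambda>x\<in>carrier R. c \<otimes> d x) \<in> N}"
  define Q where "Q = {c \<in> carrier R. \<forall>d \<in> N. \<forall>x \<in> carrier R. d (c \<otimes> x) = c \<otimes> d x}"
  have P: "additive_subgroup P R"
  proof (rule additive_subgroup_finiteI[OF finite_carrier])
    show "P \<subseteq> carrier R" by (auto simp: P_def)
    have "(\<lambda>x\<in>carrier R. \<zero> \<otimes> d x) \<in> N" if "d \<in> N" for d
    proof -
      have "(\<lambda>x\<in>carrier R. \<zero> \<otimes> d x) = (\<lambda>x\<in>carrier R. \<zero>)"
        using D(2)[OF that] by (auto simp: fun_eq_iff)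
      then show ?thesis using zeroN by simp
    qed
    then show "\<zero> \<in> P" by (simp add: P_def)
    fix a b assume ab: "a \<in> P" "b \<in> P"
    have "(\<lambda>x\<in>carrier R. (a \<oplus> b) \<otimes> d x) \<in> N" if d: "d \<in> N" for d
    proof -
      have c: "a \<in> carrier R" "b \<in> carrier R" using ab by (auto simp: P_def)
      have "(\<lambda>x\<in>carrier R. (a \<oplus> b) \<otimes> d x) = diff (\<lambda>x\<in>carrier R. a \<otimes> d x)
        (diff (\<lambda>x\<in>carrier R. \<zero>) (\<lambda>x\<in>carrier R. b \<otimes> d x))"
        using D(2)[OF d] c by (auto simp: diff_def fun_eq_iff minus_eq l_distr)
      then show ?thesis using ab d zeroN diffN by (auto simp: P_def)
    qed
    then show "a \<oplus> b \<in> P" using ab by (simp add: P_def)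
  qed
  have Q: "additive_subgroup Q R"
  proof (rule additive_subgroup_finiteI[OF finite_carrier])
    show "Q \<subseteq> carrier R" by (auto simp: Q_def)
    show "\<zero> \<in> Q" using D(2) D(4)[OF _ M.zero_closed] by (auto simp: Q_def)
    show "a \<oplus> b \<in> Q" if "a \<in> Q" "b \<in> Q" for a b
      using that D(2,3) by (auto simp: Q_def l_distr)
  qed
  have "carrier R \<subseteq> P \<union> Q"
  proof
    fix c assume c: "c \<in> carrier R"
    \<comment> \<open>The main argument needs both \<open>c\<close> and \<open>c + 1\<close> to be
      units. If \<open>c\<close> is in \<open>M\<close>, it annihilates all values, so
      \<open>c\<close> is in \<open>P\<close>. If \<open>c + 1\<close> is in \<open>M\<close>, then
      \<open>d (c x)\<close> and \<open>c d x\<close> both equal \<open>- d x\<close>, so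
      \<open>c\<close> is in \<open>Q\<close>.\<close>
    consider "c \<in> M" | "c \<in> Units R" "c \<oplus> \<one> \<in> M" | "c \<in> Units R" "c \<oplus> \<one> \<in> Units R"
      using Units_or_M c by blast
    then show "c \<in> P \<union> Q"
    proof cases
      case 1
      have "(\<lambda>x\<in>carrier R. c \<otimes> d x) \<in> N" if "d \<in> N" for d
      proof -
        have "(\<lambda>x\<in>carrier R. c \<otimes> d x) = (\<lambda>x\<in>carrier R. \<zero>)"
          using I_M[OF D(1)[OF that] 1] by (auto simp: fun_eq_iff)
        then show ?thesis using zeroN by simp
      qed
      then show ?thesis using c by (simp add: P_def)
    next
      case 2
      have "d (c \<otimes> x) = c \<otimes> d x" if d: "d \<in> N" and x: "x \<in> carrier R" for d x
      proof -
        have "d (c \<otimes> x) \<oplus> d x = d ((c \<oplus> \<one>) \<otimes> x)"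
          using D(3)[OF d] c x by (simp add: l_distr)
        also have "\<dots> = \<zero>" using D(4)[OF d] 2 x M.I_r_closed by blast
        also have "\<dots> = (c \<oplus> \<one>) \<otimes> d x" using I_M[OF D(1)[OF d x] 2(2)] by simp
        also have "\<dots> = c \<otimes> d x \<oplus> d x" using c D(2)[OF d x] by (simp add: l_distr)
        finally show ?thesis using c x D(2)[OF d] by simp
      qed
      then show ?thesis using c by (simp add: Q_def)
    next
      case 3
      define u where "u = c \<oplus> \<one>"
      have u: "u \<in> Units R" "u \<in> carrier R" using 3 by (auto simp: u_def)
      \<comment> \<open>\<open>U\<close> is the operator \<open>T (c + 1) - T c\<close>, and
        \<open>cU\<close> below is the identity \<open>c U = 1 - T (c + 1)\<close>.\<close>
      define U where "U d = diff (twist u d) (twist c d)" for d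
      have UN: "U d \<in> N" if "d \<in> N" for d using that diffN twistN 3 u by (simp add: U_def)
      have Ux: "U d x = inv u \<otimes> d (u \<otimes> x) \<ominus> inv c \<otimes> d (c \<otimes> x)" if "x \<in> carrier R" for d x
        using that by (simp add: U_def diff_def twist_def)
      have cU: "c \<otimes> U d x = d x \<ominus> inv u \<otimes> d (u \<otimes> x)" if d: "d \<in> N" and x: "x \<in> carrier R" for d x
      proof -
        note [simp] = D(2)[OF d]
        have "c \<otimes> inv u = \<one> \<ominus> inv u"
          using u c by (simp add: eq_minus_iff) (metis Units_r_inv c l_distr l_one one_closed u(1) u_def Units_inv_closed)
        then have "c \<otimes> U d x = (\<one> \<ominus> inv u) \<otimes> d (u \<otimes> x) \<ominus> d (c \<otimes> x)"
          using x c 3 u by (simp add: Ux minus_eq r_distr r_minus Units_cancel flip: m_assoc)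
        also have "d (u \<otimes> x) = d (c \<otimes> x) \<oplus> d x"
          using D(3)[OF d] c x by (simp add: u_def l_distr)
        also have "(\<one> \<ominus> inv u) \<otimes> (d (c \<otimes> x) \<oplus> d x) \<ominus> d (c \<otimes> x)
          = d x \<ominus> inv u \<otimes> (d (c \<otimes> x) \<oplus> d x)"
          using c x u by (simp add: minus_eq l_distr l_minus a_ac add_minus_cancel r_neg2)
        finally show ?thesis by (simp add: \<open>d (u \<otimes> x) = _\<close>)
      qed
      have "U ` N \<subseteq> N" using UN by blast
      then consider "U ` N = N" | "U ` N \<subset> N" by blast
      then show ?thesis
      proof cases
        case 1
        have "(\<lambda>x\<in>carrier R. c \<otimes> e x) \<in> N" if "e \<in> N" for e
        proof -
          have "e \<in> U ` N" using 1 that by simp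
          then obtain d where d: "d \<in> N" "e = U d" by blast
          have "(\<lambda>x\<in>carrier R. c \<otimes> e x) = diff d (twist u d)"
            using cU[OF d(1)] by (auto simp: d(2) fun_eq_iff diff_def twist_def)
          then show ?thesis using diffN twistN d u by simp
        qed
        then show ?thesis using c by (simp add: P_def)
      next
        case 2
        \<comment> \<open>\<open>U\<close> commutes with \<open>diff\<close> and, as
          \<open>R\<close> is commutative, with all twists. So the induction hypothesis applies to
          this proper subset.\<close>
        have "twist_stable (U ` N)"
          unfolding twist_stable_def
        proof (intro conjI ballI)
          show "U ` N \<noteq> {}" using ne by simp
          show "U ` N \<subseteq> Collect additive_slope_map" using UN asm by blast
        next
          fix d' e' assume "d' \<in> U ` N" "e' \<in> U ` N"
          then obtain d e where de: "d \<in> N" "e \<in> N" "d' = U d" "e' = U e" by blast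
          note [simp] = D(2)[OF de(1)] D(2)[OF de(2)]
          have "diff d' e' = U (diff d e)"
            using c u 3 by (auto simp: de Ux fun_eq_iff diff_def U_def twist_def
                minus_eq minus_add r_distr r_minus a_ac)
          then show "diff d' e' \<in> U ` N" using diffN[OF de(1,2)] by simp
        next
          fix b d' assume b: "b \<in> Units R" and "d' \<in> U ` N"
          then obtain d where d: "d \<in> N" "d' = U d" by blast
          note [simp] = D(2)[OF d(1)]
          have "twist b d' = U (twist b d)"
            using c u 3 b Units_closed[OF b] by (auto simp: d Ux fun_eq_iff diff_def U_def twist_def
                minus_eq minus_add r_distr r_minus m_ac)
          then show "twist b d' \<in> U ` N" using twistN[OF b d(1)] by simp
        qed
        with psubset.IH[OF 2] have lin: "U d (a \<otimes> x) = a \<otimes> U d x"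
          if "d \<in> N" "a \<in> carrier R" "x \<in> carrier R" for d a x
          using that by blast
        obtain n :: nat where n: "\<And>v. v \<in> Units R \<Longrightarrow> v [^] n \<ominus> \<one> \<in> M" "add_pow R (Suc n) \<one> \<in> M"
          using residue_exponent by blast
        have "d (c \<otimes> x) = c \<otimes> d x" if d: "d \<in> N" and x: "x \<in> carrier R" for d x
        proof -
          note [simp] = D(2)[OF d]
          \<comment> \<open>By \<open>cU\<close>, \<open>l = d - T u d\<close>. Since
            \<open>l\<close> is linear, \<open>T u\<close> fixes it, so the \<open>k\<close>-th
            power of \<open>T u\<close> sends \<open>d\<close> to \<open>d - k l\<close>; this is
            \<open>pow\<close>.\<close>
          define l where "l x = c \<otimes> U d x" for x
          have lI: "l y \<in> I" if "y \<in> carrier R" for y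
            unfolding l_def using D(1)[OF UN[OF d] that] c by (rule I.I_l_closed)
          then have l [simp]: "l y \<in> carrier R" if "y \<in> carrier R" for y
            using that I.Icarr by blast
          have l_lin: "l (a \<otimes> y) = a \<otimes> l y" if "a \<in> carrier R" "y \<in> carrier R" for a y
            using lin[OF d that] that c D(2)[OF UN[OF d]] by (simp add: l_def m_lcomm)
          have step: "d (u \<otimes> y) = u \<otimes> (d y \<ominus> l y)" if y: "y \<in> carrier R" for y
          proof -
            have "d y \<ominus> l y = inv u \<otimes> d (u \<otimes> y)"
              using cU[OF d y] y u by (simp add: l_def minus_eq minus_add a_ac add_minus_cancel r_neg2)
            then show ?thesis using y u by (simp add: Units_cancel)
          qed
          have pow: "d (u [^] k \<otimes> x) = u [^] k \<otimes> (d x \<ominus> add_pow R k (l x))" for k :: nat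
          proof (induction k)
            case (Suc k)
            have "d (u [^] Suc k \<otimes> x) = d (u \<otimes> (u [^] k \<otimes> x))"
              using u x by (simp add: m_ac)
            also have "\<dots> = u \<otimes> (u [^] k \<otimes> (d x \<ominus> add_pow R k (l x)) \<ominus> u [^] k \<otimes> l x)"
              using u x by (simp add: step Suc.IH l_lin)
            also have "\<dots> = u [^] Suc k \<otimes> (d x \<ominus> add_pow R (Suc k) (l x))"
              using u x by (simp add: minus_eq minus_add r_distr r_minus m_ac a_ac)
            finally show ?case .
          qed (use x in \<open>simp add: minus_eq\<close>)
          \<comment> \<open>As \<open>u [^] n\<close> is congruent to \<open>1\<close> modulo
            \<open>M\<close>, the \<open>n\<close>-th power of \<open>T u\<close> fixes
            \<open>d\<close>, so \<open>n l x = 0\<close>. But \<open>(n + 1) l x = 0\<close> as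
            well, because \<open>n + 1\<close> is zero in the residue field. Hence
            \<open>l x = 0\<close>.\<close>
          have "(u [^] n \<otimes> x) \<ominus> x = (u [^] n \<ominus> \<one>) \<otimes> x"
            using u x by (simp add: minus_eq l_distr l_minus)
          then have "(u [^] n \<otimes> x) \<ominus> x \<in> M" using n(1)[OF u(1)] x M.I_r_closed by simp
          then have "d x = d (u [^] n \<otimes> x)"
            using additive_slope_map_cong[OF asm[OF d]] x u by (metis m_closed nat_pow_closed)
          also have "\<dots> = \<one> \<otimes> (d x \<ominus> add_pow R n (l x))"
            unfolding pow
          proof (rule mult_I_cong)
            have "add_pow R k (l x) \<in> I" for k :: nat
              by (induction k) (use lI[OF x] in simp_all)
            then show "d x \<ominus> add_pow R n (l x) \<in> I" using D(1)[OF d x] by simp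
          qed (use n(1)[OF u(1)] u in auto)
          finally have nl: "d x = d x \<ominus> add_pow R n (l x)" using x by simp
          have "add_pow R (Suc n) (l x) = add_pow R (Suc n) \<one> \<otimes> l x"
            using x add_pow_ldistr[of \<one> "l x" "Suc n"] by simp
          also have "\<dots> = \<zero>" using I_M[OF lI[OF x] n(2)] .
          finally have "add_pow R n (l x) \<oplus> l x = \<zero>" using x by simp
          moreover have "d x \<oplus> add_pow R n (l x) = d x"
            by (rule eq_minus_iff[THEN iffD1, OF _ _ _ nl]) (use x in simp_all)
          then have "add_pow R n (l x) = \<zero>" using x by simp
          ultimately have "l x = \<zero>" using x by simp
          then have "d (u \<otimes> x) = u \<otimes> d x" using step[OF x] x u by (simp add: minus_eq)
          moreover have "d (u \<otimes> x) = d (c \<otimes> x) \<oplus> d x"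
            using D(3)[OF d] c x by (simp add: u_def l_distr)
          ultimately show ?thesis using c x by (simp add: u_def l_distr)
        qed
        then show ?thesis using c by (simp add: Q_def)
      qed
    qed
  qed
  then consider "carrier R \<subseteq> P" | "carrier R \<subseteq> Q"
    using additive_subgroup_Un[OF P Q] by blast
  then show ?case
  proof cases
    case 1
    have "d x = \<zero>" if d: "d \<in> N" and x: "x \<in> carrier R" for d x
    proof (cases "x \<in> M")
      case True
      then show ?thesis using D(4)[OF d] by blast
    next
      case False
      then have xU: "x \<in> Units R" using x Units_or_M by blast
      have "inv x \<otimes> d x = \<zero>"
      proof (rule pure)
        show "inv x \<otimes> d x \<in> I" using D(1)[OF d x] xU by (simp add: I.I_l_closed)
        fix r assume r: "r \<in> carrier R"
        \<comment> \<open>The slope of \<open>r d\<close> at \<open>x\<close> is \<open>r\<close>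
          times that of \<open>d\<close>, so all multiples of the slope of \<open>d\<close> stay in
          \<open>J\<close>.\<close>
        then have "(\<lambda>x\<in>carrier R. r \<otimes> d x) \<in> N" using 1 d by (auto simp: P_def)
        from D(5)[OF this xU] show "r \<otimes> (inv x \<otimes> d x) \<in> J"
          using x xU r D(2)[OF d x] by (simp add: m_lcomm)
      qed
      then have "x \<otimes> (inv x \<otimes> d x) = \<zero>" using x by simp
      then show ?thesis using xU D(2)[OF d x] by (simp add: Units_cancel)
    qed
    then show ?thesis by (metis m_closed r_null)
  qed (auto simp: Q_def)
qed

section \<open>Affine maps and finite differences\<close>

definition affine_map :: "('a \<Rightarrow> 'a) \<Rightarrow> bool" where
  "affine_map d \<longleftrightarrow> (\<exists>j \<in> J. \<forall>x \<in> carrier R. d x = d \<zero> \<oplus> x \<otimes> j)"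

definition delta :: "'a \<Rightarrow> ('a \<Rightarrow> 'a) \<Rightarrow> 'a \<Rightarrow> 'a" where
  "delta y d = (\<lambda>x. d (x \<oplus> y) \<ominus> d x)"

definition affine_shifts :: "('a \<Rightarrow> 'a) \<Rightarrow> 'a set" where
  "affine_shifts d = {y \<in> carrier R. affine_map (delta y d)}"

lemma affine_map_cong:
  assumes "\<And>x. x \<in> carrier R \<Longrightarrow> d x = e x" shows "affine_map d \<longleftrightarrow> affine_map e"
  using assms by (simp add: affine_map_def)

lemma J_carrier [simp]: "j \<in> J \<Longrightarrow> j \<in> carrier R"
  using J_subset I.Icarr by blast

lemma affine_map_const: "c \<in> carrier R \<Longrightarrow> affine_map (\<lambda>_. c)"
  unfolding affine_map_def by (rule bexI[of _ \<zero>]) simp_all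

lemma affine_map_add:
  assumes d: "affine_map d" and e: "affine_map e"
    and [simp]: "d \<zero> \<in> carrier R" "e \<zero> \<in> carrier R"
  shows "affine_map (\<lambda>x. d x \<oplus> e x)"
proof -
  obtain j where j: "j \<in> J" "\<And>x. x \<in> carrier R \<Longrightarrow> d x = d \<zero> \<oplus> x \<otimes> j"
    using d unfolding affine_map_def by blast
  obtain k where k: "k \<in> J" "\<And>x. x \<in> carrier R \<Longrightarrow> e x = e \<zero> \<oplus> x \<otimes> k"
    using e unfolding affine_map_def by blast
  have "d x \<oplus> e x = (d \<zero> \<oplus> e \<zero>) \<oplus> x \<otimes> (j \<oplus> k)" if "x \<in> carrier R" for x
    using that j(1) k(1) j(2)[OF that] k(2)[OF that] by (simp add: r_distr a_ac)
  then show ?thesis using j(1) k(1) unfolding affine_map_def by blast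
qed

lemma affine_map_shift:
  assumes d: "affine_map d" and z: "z \<in> carrier R" and [simp]: "d \<zero> \<in> carrier R"
  shows "affine_map (\<lambda>x. d (x \<oplus> z))"
proof -
  obtain j where j: "j \<in> J" "\<And>x. x \<in> carrier R \<Longrightarrow> d x = d \<zero> \<oplus> x \<otimes> j"
    using d unfolding affine_map_def by blast
  have "d (x \<oplus> z) = d (\<zero> \<oplus> z) \<oplus> x \<otimes> j" if "x \<in> carrier R" for x
    using that z j(1) j(2)[of "x \<oplus> z"] j(2)[of z] by (simp add: l_distr a_ac)
  then show ?thesis using j(1) unfolding affine_map_def by blast
qed

lemma affine_map_delta:
  assumes d: "affine_map d" and y: "y \<in> carrier R" and [simp]: "d \<zero> \<in> carrier R"
  shows "affine_map (delta y d)"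
proof -
  obtain j where j: "j \<in> J" "\<And>x. x \<in> carrier R \<Longrightarrow> d x = d \<zero> \<oplus> x \<otimes> j"
    using d unfolding affine_map_def by blast
  have "delta y d x = y \<otimes> j" if "x \<in> carrier R" for x
    using that y j(1) j(2)[of "x \<oplus> y"] j(2)[of x]
    by (simp add: delta_def minus_eq_iff l_distr a_ac)
  then have "affine_map (delta y d) \<longleftrightarrow> affine_map (\<lambda>_. y \<otimes> j)" by (rule affine_map_cong)
  then show ?thesis using affine_map_const y j(1) by simp
qed

lemma slope_map_carrier: "slope_map d \<Longrightarrow> x \<in> carrier R \<Longrightarrow> d x \<in> carrier R"
  using slope_map_I I.Icarr by blast

lemma slope_map_delta:
  assumes d: "slope_map d" and y: "y \<in> carrier R"
  shows "slope_map (delta y d)"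
  unfolding slope_map_def
proof (intro conjI ballI impI)
  show "delta y d \<in> carrier R \<rightarrow> I" using slope_map_I[OF d] y by (auto simp: delta_def)
  fix x z assume x: "x \<in> carrier R" and z: "z \<in> carrier R" and u: "x \<ominus> z \<in> Units R"
  note [simp] = slope_map_carrier[OF d]
  have eq: "(x \<oplus> y) \<ominus> (z \<oplus> y) = x \<ominus> z"
    using x y z by (simp add: minus_eq_iff) (simp add: minus_eq a_ac add_minus_cancel r_neg r_neg1 r_neg2)
  have "inv (x \<ominus> z) \<otimes> (d (x \<oplus> y) \<ominus> d (z \<oplus> y)) \<in> J"
    using d x y z u eq unfolding slope_map_def by (metis a_closed)
  moreover have "inv (x \<ominus> z) \<otimes> (d x \<ominus> d z) \<in> J"
    using d x z u unfolding slope_map_def by blast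
  moreover have "inv (x \<ominus> z) \<otimes> (delta y d x \<ominus> delta y d z) =
      inv (x \<ominus> z) \<otimes> (d (x \<oplus> y) \<ominus> d (z \<oplus> y)) \<ominus> inv (x \<ominus> z) \<otimes> (d x \<ominus> d z)"
    using x y z u Units_inv_closed[OF u]
    by (simp add: delta_def minus_eq minus_add r_distr r_minus a_ac minus_minus)
  ultimately show "inv (x \<ominus> z) \<otimes> (delta y d x \<ominus> delta y d z) \<in> J" using J_minus by simp
qed

text \<open>The value is the slope of \<open>d\<close> between \<open>x\<close> and
  \<open>x + y\<close>. Thus all values of \<open>delta y d\<close> lie in
  \<open>y J\<close>.\<close>

lemma slope_map_delta_value:
  assumes d: "slope_map d" and y: "y \<in> Units R" and x: "x \<in> carrier R"
  shows "inv y \<otimes> delta y d x \<in> J"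
proof -
  have "(x \<oplus> y) \<ominus> x = y" using x Units_closed[OF y] by (simp add: minus_eq_iff a_ac)
  then show ?thesis
    using d x y Units_closed[OF y] unfolding slope_map_def delta_def by (metis a_closed)
qed

text \<open>The cocycle identity \<open>delta (y + z) d x = delta y d (x + z) + delta z d x\<close>
  gives closure under addition, since affine maps are stable under sums and translations.\<close>

lemma additive_subgroup_affine_shifts:
  assumes d: "slope_map d" shows "additive_subgroup (affine_shifts d) R"
proof (rule additive_subgroup_finiteI[OF finite_carrier])
  note [simp] = slope_map_carrier[OF d]
  have "affine_map (delta \<zero> d) \<longleftrightarrow> affine_map (\<lambda>_. \<zero>)"
    by (rule affine_map_cong) (simp add: delta_def minus_eq r_neg)
  then show "\<zero> \<in> affine_shifts d" using affine_map_const by (simp add: affine_shifts_def)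
  fix y z assume "y \<in> affine_shifts d" "z \<in> affine_shifts d"
  then have y: "y \<in> carrier R" "affine_map (delta y d)" and z: "z \<in> carrier R" "affine_map (delta z d)"
    by (auto simp: affine_shifts_def)
  have "affine_map (delta (y \<oplus> z) d) \<longleftrightarrow> affine_map (\<lambda>x. delta y d (x \<oplus> z) \<oplus> delta z d x)"
    using y(1) z(1) by (intro affine_map_cong) (simp add: delta_def minus_eq a_ac r_neg1 r_neg2)
  also have \<dots>
    using y z by (intro affine_map_add affine_map_shift) (simp_all add: delta_def)
  finally show "y \<oplus> z \<in> affine_shifts d" using y z by (simp add: affine_shifts_def)
qed (auto simp: affine_shifts_def)

text \<open>By \<open>slope_map_cong\<close>, \<open>delta y d\<close> vanishes for \<open>y\<close>
  in \<open>M\<close>.\<close>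

lemma M_subset_affine_shifts:
  assumes d: "slope_map d" shows "M \<subseteq> affine_shifts d"
proof
  fix y assume y: "y \<in> M"
  have "delta y d x = \<zero>" if x: "x \<in> carrier R" for x
  proof -
    have "(x \<oplus> y) \<ominus> x = y" using x M.Icarr[OF y] by (simp add: minus_eq_iff a_ac)
    then have "d (x \<oplus> y) = d x" using slope_map_cong[OF d] x y M.Icarr by simp
    then show ?thesis using slope_map_carrier[OF d x] by (simp add: delta_def minus_eq r_neg)
  qed
  then have "affine_map (delta y d) \<longleftrightarrow> affine_map (\<lambda>_. \<zero>)" by (rule affine_map_cong)
  then show "y \<in> affine_shifts d" using affine_map_const M.Icarr[OF y] by (simp add: affine_shifts_def)
qed

text \<open>The operators \<open>delta y\<close> and \<open>delta z\<close> commute, and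
  \<open>delta y\<close> preserves affine maps.\<close>

lemma affine_shifts_delta:
  assumes d: "slope_map d" and y: "y \<in> carrier R"
  shows "affine_shifts d \<subseteq> affine_shifts (delta y d)"
proof
  fix z assume "z \<in> affine_shifts d"
  then have z: "z \<in> carrier R" "affine_map (delta z d)" by (auto simp: affine_shifts_def)
  note [simp] = slope_map_carrier[OF d]
  have "affine_map (delta z (delta y d)) \<longleftrightarrow> affine_map (delta y (delta z d))"
    using y z(1) by (intro affine_map_cong) (simp add: delta_def minus_eq minus_add a_ac minus_minus)
  also have \<dots> using z(1) by (intro affine_map_delta[OF z(2) y]) (simp add: delta_def)
  finally show "z \<in> affine_shifts (delta y d)" using z by (simp add: affine_shifts_def)
qed

text \<open>If \<open>y\<close> is not an affine shift of \<open>e\<close>, then \<open>delta y\<close> keeps \<open>e\<close> non-affine and, for \<open>e\<close> with a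
  maximal number of affine shifts, keeps the set of affine shifts. Applying all these operators
  forces the values into \<open>y \<otimes> J\<close> for more than half of all \<open>y\<close>, hence to vanish.\<close>

lemma exists_all_affine_shifts:
  assumes "slope_map d" "\<not> affine_map d"
  shows "\<exists>e. slope_map e \<and> \<not> affine_map e \<and> affine_shifts e = carrier R"
proof -
  let ?P = "\<lambda>e. slope_map e \<and> \<not> affine_map e"
  have le: "card (affine_shifts e) \<le> card (carrier R)" for e
    by (rule card_mono[OF finite_carrier]) (auto simp: affine_shifts_def)
  have "\<exists>e. ?P e \<and> (\<forall>e'. ?P e' \<longrightarrow> card (affine_shifts e') \<le> card (affine_shifts e))"
    by (rule ex_has_greatest_nat[where k = d and b = "Suc (card (carrier R))"]) (use assms le in \<open>auto simp: less_Suc_eq_le\<close>)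
  then obtain e where "?P e \<and> (\<forall>e'. ?P e' \<longrightarrow> card (affine_shifts e') \<le> card (affine_shifts e))" ..
  then have e: "?P e"
    and max: "\<And>e'. ?P e' \<Longrightarrow> card (affine_shifts e') \<le> card (affine_shifts e)" by simp_all
  define Z where "Z = affine_shifts e"
  have Zsub: "additive_subgroup Z R" unfolding Z_def using e by (blast intro: additive_subgroup_affine_shifts)
  have MZ: "M \<subseteq> Z" unfolding Z_def using e M_subset_affine_shifts by blast
  have "Z = carrier R"
  proof (rule ccontr)
    assume ne: "Z \<noteq> carrier R"
    have ZU: "y \<in> Units R" if "y \<in> carrier R - Z" for y
      using that MZ Units_or_M by blast
    \<comment> \<open>The operators \<open>delta y\<close> are applied for one \<open>y\<close>
      outside \<open>Z\<close> after another. The result is not affine because \<open>y\<close> is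
      not an affine shift; its affine shifts contain \<open>Z\<close> and by maximality equal
      \<open>Z\<close>. Values already in \<open>z J\<close> remain there, as the new values are
      differences of old ones.\<close>
    have "\<exists>e'. ?P e' \<and> affine_shifts e' = Z \<and> (\<forall>y \<in> Y. \<forall>x \<in> carrier R. inv y \<otimes> e' x \<in> J)"
      if "finite Y" "Y \<subseteq> carrier R - Z" for Y
      using that
    proof (induction Y)
      case empty
      then show ?case using e Z_def by auto
    next
      case (insert y Y)
      then obtain f where f: "?P f" "affine_shifts f = Z"
        "\<And>y x. y \<in> Y \<Longrightarrow> x \<in> carrier R \<Longrightarrow> inv y \<otimes> f x \<in> J" by auto
      have y: "y \<in> carrier R" "y \<notin> Z" "y \<in> Units R" using insert.prems ZU by auto
      have P: "?P (delta y f)"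
        using f y slope_map_delta by (auto simp: affine_shifts_def)
      have "Z \<subseteq> affine_shifts (delta y f)" using affine_shifts_delta f y by blast
      moreover have "card (affine_shifts (delta y f)) \<le> card Z" using max[OF P] Z_def by simp
      moreover have "finite (affine_shifts (delta y f))"
        by (rule finite_subset[OF _ finite_carrier]) (auto simp: affine_shifts_def)
      ultimately have "affine_shifts (delta y f) = Z" using card_seteq by blast
      moreover have "inv z \<otimes> delta y f x \<in> J" if z: "z \<in> insert y Y" and x: "x \<in> carrier R" for z x
      proof (cases "z = y")
        case True
        then show ?thesis using slope_map_delta_value f y x by simp
      next
        case False
        then have zY: "z \<in> Y" using z by simp
        then have zU: "z \<in> Units R" using insert.prems ZU by blast
        have "inv z \<otimes> delta y f x = inv z \<otimes> f (x \<oplus> y) \<ominus> inv z \<otimes> f x"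
          using zU x y slope_map_carrier f(1) by (simp add: delta_def minus_eq r_distr r_minus)
        then show ?thesis using J_minus f(3)[OF zY] x y by simp
      qed
      ultimately show ?case using P by blast
    qed
    from this[of "carrier R - Z"] obtain f where f: "?P f"
      "\<And>y x. y \<in> carrier R - Z \<Longrightarrow> x \<in> carrier R \<Longrightarrow> inv y \<otimes> f x \<in> J"
      using finite_carrier by auto
    have "f x = \<zero>" if x: "x \<in> carrier R" for x
    proof -
      \<comment> \<open>\<open>B\<close> contains the inverses of all elements outside
        \<open>Z\<close>, at least half as many as \<open>R\<close> has elements, and also
        \<open>0\<close>, which makes a strict majority. So the additive group \<open>B\<close> is
        all of \<open>R\<close>, and purity applies to \<open>f x\<close>.\<close>
      define B where "B = {b \<in> carrier R. b \<otimes> f x \<in> J}"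
      have fx: "f x \<in> I" "f x \<in> carrier R" using f x slope_map_I slope_map_carrier by auto
      have B: "additive_subgroup B R"
        by (rule additive_subgroup_finiteI[OF finite_carrier])
          (use fx in \<open>auto simp: B_def l_distr\<close>)
      have "insert \<zero> (m_inv R ` (carrier R - Z)) \<subseteq> B"
        using f(2) x ZU fx by (auto simp: B_def)
      moreover have "finite B" using finite_carrier by (simp add: B_def)
      ultimately have "card (insert \<zero> (m_inv R ` (carrier R - Z))) \<le> card B"
        by (rule card_mono[rotated])
      moreover have "\<zero> \<notin> m_inv R ` (carrier R - Z)"
        using ZU Units_inv_Units Units_eq M.zero_closed by (metis DiffD2 imageE)
      moreover have "inj_on (m_inv R) (carrier R - Z)"
        using ZU Units_inv_inv by (metis inj_onI)
      ultimately have "Suc (card (carrier R - Z)) \<le> card B"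
        using finite_carrier by (simp add: card_image)
      moreover have "card (carrier R - Z) = card (carrier R) - card Z"
        using finite_carrier Zsub additive_subgroup.a_subset by (metis card_Diff_subset finite_subset)
      moreover have "2 * card Z \<le> card (carrier R)"
        by (rule card_proper_additive_subgroup[OF finite_carrier Zsub ne])
      ultimately have "B = carrier R"
        by (intro additive_subgroup_eq_carrier[OF finite_carrier B]) linarith
      then show ?thesis using pure[OF fx(1)] by (auto simp: B_def)
    qed
    then have "affine_map f \<longleftrightarrow> affine_map (\<lambda>_. \<zero>)" by (rule affine_map_cong)
    then show False using f affine_map_const by simp
  qed
  then show ?thesis using e Z_def by blast
qed

text \<open>A counterexample may be taken with all shifts affine. After subtracting its value at
  \<open>0\<close>, it satisfies \<open>f (x + y) = f x + f y + x a y\<close> with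
  \<open>a y\<close> in \<open>J\<close>. Symmetry gives \<open>a y = y a 1\<close>, so all
  multiples of \<open>a 1\<close> lie in \<open>J\<close> and \<open>a\<close> vanishes. Then
  \<open>f\<close> is additive, and \<open>twist_stable_linear\<close> makes it linear, a
  contradiction.\<close>

theorem slope_map_affine:
  assumes "slope_map d" shows "affine_map d"
proof (rule ccontr)
  assume "\<not> affine_map d"
  then obtain e where e: "slope_map e" "\<not> affine_map e" "affine_shifts e = carrier R"
    using exists_all_affine_shifts assms by blast
  note [simp] = slope_map_carrier[OF e(1)]
  define f where "f x = e x \<ominus> e \<zero>" for x
  have fI: "f x \<in> I" if "x \<in> carrier R" for x
    using slope_map_I[OF e(1)] that by (simp add: f_def)
  then have [simp]: "f x \<in> carrier R" if "x \<in> carrier R" for x using that I.Icarr by blast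
  have f0: "f \<zero> = \<zero>" by (simp add: f_def minus_eq r_neg)
  have "f x \<ominus> f y = e x \<ominus> e y" if "x \<in> carrier R" "y \<in> carrier R" for x y
    using that by (simp add: f_def minus_eq minus_add a_ac r_neg1 r_neg2 add_minus_cancel minus_minus)
  then have f: "slope_map f" and fd: "\<And>x y. x \<in> carrier R \<Longrightarrow> y \<in> carrier R \<Longrightarrow> delta y f x = delta y e x"
    using e(1) fI by (auto simp: slope_map_def delta_def)
  have "\<exists>j \<in> J. \<forall>x \<in> carrier R. f (x \<oplus> y) = f x \<oplus> f y \<oplus> x \<otimes> j" if y: "y \<in> carrier R" for y
  proof -
    have "affine_map (delta y e)" using e(3) y by (auto simp: affine_shifts_def)
    then have "affine_map (delta y f)" using affine_map_cong fd y by blast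
    then obtain j where j: "j \<in> J" "\<And>x. x \<in> carrier R \<Longrightarrow> delta y f x = delta y f \<zero> \<oplus> x \<otimes> j"
      unfolding affine_map_def by blast
    have "f (x \<oplus> y) = f x \<oplus> f y \<oplus> x \<otimes> j" if x: "x \<in> carrier R" for x
      using j(1) j(2)[OF x] x y by (simp add: delta_def f0 minus_eq_iff a_ac) (simp add: minus_eq a_ac)
    then show ?thesis using j(1) by blast
  qed
  then obtain a where a: "\<And>y. y \<in> carrier R \<Longrightarrow> a y \<in> J"
    "\<And>x y. x \<in> carrier R \<Longrightarrow> y \<in> carrier R \<Longrightarrow> f (x \<oplus> y) = f x \<oplus> f y \<oplus> x \<otimes> a y"
    by metis
  have sym: "x \<otimes> a y = y \<otimes> a x" if "x \<in> carrier R" "y \<in> carrier R" for x y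
  proof -
    have "f x \<oplus> f y \<oplus> x \<otimes> a y = f x \<oplus> f y \<oplus> y \<otimes> a x"
      using a(2)[OF that] a(2)[OF that(2,1)] that a(1) by (simp add: a_ac)
    then show ?thesis using that a(1) by simp
  qed
  have a1: "a y = y \<otimes> a \<one>" if "y \<in> carrier R" for y
    using sym[of \<one> y] that a(1) by simp
  have "a \<one> = \<zero>"
  proof (rule pure)
    show "a \<one> \<in> I" using a(1) J_subset by blast
    show "r \<otimes> a \<one> \<in> J" if "r \<in> carrier R" for r
      using a(1)[OF that] a1[OF that] by simp
  qed
  then have add: "f (x \<oplus> y) = f x \<oplus> f y" if "x \<in> carrier R" "y \<in> carrier R" for x y
    using a(2)[OF that] a1[OF that(2)] that by simp
  \<comment> \<open>Restriction makes \<open>g\<close> extensional. The set of all additive slope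
    maps is then finite, and it is the twist-stable set to which the linearity result is
    applied.\<close>
  define g where "g = restrict f (carrier R)"
  have g: "additive_slope_map g"
    unfolding additive_slope_map_def
  proof (intro conjI ballI)
    show "g \<in> carrier R \<rightarrow>\<^sub>E I" using fI by (simp add: g_def)
    show "g (x \<oplus> y) = g x \<oplus> g y" if "x \<in> carrier R" "y \<in> carrier R" for x y
      using that add by (simp add: g_def)
    show "g x = \<zero>" if "x \<in> M" for x
      using slope_map_cong[OF f, of x \<zero>] that M.Icarr[OF that] by (simp add: g_def f0 minus_eq)
    show "inv u \<otimes> g u \<in> J" if "u \<in> Units R" for u
    proof -
      have "u \<ominus> \<zero> = u" "f u \<ominus> f \<zero> = f u"
        using Units_closed[OF that] by (simp_all add: f0 minus_eq)
      then have "inv u \<otimes> f u \<in> J"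
        using f that Units_closed[OF that] unfolding slope_map_def by (metis zero_closed)
      then show ?thesis using Units_closed[OF that] by (simp add: g_def)
    qed
  qed
  have "finite (Collect additive_slope_map)"
  proof (rule finite_subset)
    show "Collect additive_slope_map \<subseteq> carrier R \<rightarrow>\<^sub>E carrier R"
      by (auto simp: PiE_def dest: additive_slope_mapD(2,6))
  qed (simp add: finite_carrier finite_PiE)
  moreover have "twist_stable (Collect additive_slope_map)"
    unfolding twist_stable_def using g additive_slope_map_diff additive_slope_map_twist by auto
  ultimately have lin: "g (c \<otimes> x) = c \<otimes> g x" if "c \<in> carrier R" "x \<in> carrier R" for c x
    using twist_stable_linear g that by blast
  have g1: "g \<one> \<in> J"
    using additive_slope_mapD(5)[OF g, of \<one>] additive_slope_mapD(2)[OF g] by simp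
  have eq: "e x = e \<zero> \<oplus> x \<otimes> g \<one>" if x: "x \<in> carrier R" for x
  proof -
    have "g x = x \<otimes> g \<one>" using lin[OF x one_closed] x by simp
    then have "e x \<ominus> e \<zero> = x \<otimes> g \<one>" using x by (simp add: g_def f_def)
    then show ?thesis using x g1 by (simp add: minus_eq_iff a_ac)
  qed
  have "affine_map e"
    unfolding affine_map_def by (intro bexI[where x = "g \<one>"] ballI eq g1)
  then show False using e(2) by contradiction
qed

end

subsection \<open>Automorphisms of cyclotomic schemes\<close>

text \<open>The principal ideal of a nonunit is proper, and a proper ideal containing
  \<open>x\<close> of greatest cardinality is maximal.\<close>

lemma (in cring) exists_maximalideal_containing:
  assumes fin: "finite (carrier R)" and x: "x \<in> carrier R" "x \<notin> Units R"
  obtains P where "maximalideal P R" "x \<in> P"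
proof -
  let ?Q = "\<lambda>P. ideal P R \<and> x \<in> P \<and> P \<noteq> carrier R"
  have "PIdl x \<noteq> carrier R"
  proof
    assume "PIdl x = carrier R"
    then obtain r where "r \<in> carrier R" "\<one> = r \<otimes> x"
      using one_closed unfolding cgenideal_def by blast
    then show False using x m_comm by (metis (mono_tags, lifting) Units_def mem_Collect_eq)
  qed
  then have Q: "?Q (PIdl x)" using x cgenideal_ideal cgenideal_self by blast
  have "\<exists>P. ?Q P \<and> (\<forall>P'. ?Q P' \<longrightarrow> card P' \<le> card P)"
  proof (rule ex_has_greatest_nat[where P = ?Q and f = card, OF Q], intro allI impI)
    fix P assume "?Q P"
    then have "P \<subseteq> carrier R" by (meson ideal.Icarr subsetI)
    then show "card P < Suc (card (carrier R))" using fin by (simp add: card_mono less_Suc_eq_le)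
  qed
  then obtain P where "?Q P \<and> (\<forall>P'. ?Q P' \<longrightarrow> card P' \<le> card P)" ..
  then have P: "?Q P" and max: "\<And>P'. ?Q P' \<Longrightarrow> card P' \<le> card P" by simp_all
  have "maximalideal P R"
  proof (rule maximalidealI)
    show "ideal P R" "carrier R \<noteq> P" using P by auto
    fix P' assume P': "ideal P' R" "P \<subseteq> P'" "P' \<subseteq> carrier R"
    show "P' = P \<or> P' = carrier R"
    proof (rule disjCI)
      assume "P' \<noteq> carrier R"
      then have "card P' \<le> card P" using max[of P'] P' P by blast
      then show "P' = P" using P'(2,3) fin by (metis card_seteq finite_subset)
    qed
  qed
  then show ?thesis using that P by blast
qed

text \<open>Every nonunit lies in some maximal ideal, and the only one is \<open>rad R\<close>. This
  yields locality in the form \<open>Units_eq\<close>.\<close>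

lemma local_ring_finite_local_ring:
  fixes R (structure)
  assumes "local_ring R" "finite (carrier R)"
  shows "finite_local_ring R (rad R)"
proof -
  interpret cring R using assms by (simp add: local_ring_def)
  have ex1: "\<exists>!P. maximalideal P R" using assms by (simp add: local_ring_def)
  then have max: "maximalideal (rad R) R" unfolding rad_def by (rule theI')
  interpret M: maximalideal "rad R" R by (rule max)
  have "Units R = carrier R - rad R"
  proof (intro equalityI subsetI)
    fix u assume u: "u \<in> Units R"
    have "u \<notin> rad R"
      using M.I_l_closed[of u "inv u"] u M.one_imp_carrier M.I_notcarr by auto
    then show "u \<in> carrier R - rad R" using u Units_closed by blast
  next
    fix u assume u: "u \<in> carrier R - rad R"
    show "u \<in> Units R"
    proof (rule ccontr)
      assume "u \<notin> Units R"
      then obtain P where "maximalideal P R" "u \<in> P"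
        using exists_maximalideal_containing[OF assms(2)] u by blast
      then show False using ex1 max u by blast
    qed
  qed
  then show ?thesis
    by (intro finite_local_ring.intro finite_local_ring_axioms.intro)
      (simp_all add: is_cring assms max)
qed

text \<open>Forwards, \<open>(x, y)\<close> lies in the relation of \<open>r = y - x\<close> because
  \<open>1\<close> is in \<open>K\<close>. Backwards, elements of \<open>K\<close> are cancellable,
  so \<open>f\<close> is injective and, by finiteness, bijective. It maps each relation into itself
  as \<open>K\<close> is multiplicatively closed, and onto itself again by finiteness.\<close>

lemma (in cring) cyc_aut_iff:
  assumes fin: "finite (carrier R)" and K: "K \<subseteq> Units R" "\<one> \<in> K"
    and closed: "\<And>k l. k \<in> K \<Longrightarrow> l \<in> K \<Longrightarrow> k \<otimes> l \<in> K"
  shows "f \<in> cyc_aut R K \<longleftrightarrow> f \<in> carrier R \<rightarrow> carrier R \<and>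
    (\<forall>x \<in> carrier R. \<forall>y \<in> carrier R. \<exists>k \<in> K. f y \<ominus> f x = (y \<ominus> x) \<otimes> k)" (is "_ \<longleftrightarrow> ?R")
proof
  have Kc: "k \<in> K \<Longrightarrow> k \<in> carrier R" for k using K Units_closed by blast
  define S where "S r = {(x, y). x \<in> carrier R \<and> y \<in> carrier R \<and> y \<ominus> x \<in> (\<lambda>k. r \<otimes> k) ` K}" for r
  have rels: "cyc_rels R K = S ` carrier R" by (simp add: cyc_rels_def S_def)
  {
    assume f: "f \<in> cyc_aut R K"
    then have closed: "f \<in> carrier R \<rightarrow> carrier R" by (auto simp: cyc_aut_def bij_betw_def)
    have "\<exists>k \<in> K. f y \<ominus> f x = (y \<ominus> x) \<otimes> k" if xy: "x \<in> carrier R" "y \<in> carrier R" for x y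
    proof -
      have "(x, y) \<in> S (y \<ominus> x)"
        using xy K(2) by (auto simp: S_def intro!: image_eqI[of _ _ \<one>])
      moreover have "(\<lambda>(x, y). (f x, f y)) ` S (y \<ominus> x) = S (y \<ominus> x)"
        using f xy by (auto simp: cyc_aut_def rels)
      ultimately have "(f x, f y) \<in> S (y \<ominus> x)" by force
      then show ?thesis by (auto simp: S_def)
    qed
    then show ?R using closed by blast
  }
  assume R: ?R
  then have fc: "f x \<in> carrier R" if "x \<in> carrier R" for x using that by blast
  have inj: "inj_on f (carrier R)"
  proof (rule inj_onI)
    fix x y assume xy: "x \<in> carrier R" "y \<in> carrier R" "f x = f y"
    then obtain k where k: "k \<in> K" "f y \<ominus> f x = (y \<ominus> x) \<otimes> k" using R by blast
    then have "(y \<ominus> x) \<otimes> k = \<zero>" using xy fc by (simp add: minus_eq r_neg)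
    then have "(y \<ominus> x) \<otimes> k \<otimes> inv k = \<zero>" using k(1) K by auto
    then have "y \<ominus> x = \<zero>" using k(1) K xy Kc by (simp add: m_assoc subset_iff)
    then show "x = y" using xy by (simp add: minus_eq_iff)
  qed
  have "bij_betw f (carrier R) (carrier R)"
    using inj fc fin by (simp add: bij_betw_def endo_inj_surj image_subset_iff)
  moreover have "(\<lambda>(x, y). (f x, f y)) ` S r = S r" if r: "r \<in> carrier R" for r
  proof (rule endo_inj_surj)
    show "finite (S r)"
      by (rule finite_subset[of _ "carrier R \<times> carrier R"]) (auto simp: S_def fin)
    show "inj_on (\<lambda>(x, y). (f x, f y)) (S r)"
      using inj by (auto simp: inj_on_def S_def)
    show "(\<lambda>(x, y). (f x, f y)) ` S r \<subseteq> S r"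
    proof clarify
      fix x y assume "(x, y) \<in> S r"
      then obtain k where xy: "x \<in> carrier R" "y \<in> carrier R" and k: "k \<in> K" "y \<ominus> x = r \<otimes> k"
        by (auto simp: S_def)
      obtain l where l: "l \<in> K" "f y \<ominus> f x = (y \<ominus> x) \<otimes> l" using R xy by blast
      have "f y \<ominus> f x = r \<otimes> (k \<otimes> l)" using k l r Kc by (simp add: m_assoc)
      then show "(f x, f y) \<in> S r" using closed[OF k(1) l(1)] xy fc by (auto simp: S_def)
    qed
  qed
  ultimately show "f \<in> cyc_aut R K" by (auto simp: cyc_aut_def rels)
qed

section \<open>The slope system of a pure group and the automorphisms of its scheme\<close>

locale pure_cyclotomic = finite_local_ring +
  fixes I K
  assumes I_ideal: "ideal I R" and I_subset: "I \<subseteq> M"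
    and I_M: "\<lbrakk>v \<in> I; x \<in> M\<rbrakk> \<Longrightarrow> x \<otimes> v = \<zero>"
    and K_subgroup: "subgroup K (units_of R)"
    and K_pure: "pure_group R K"
begin

definition J where "J = {j \<in> I. \<one> \<oplus> j \<in> K}"

lemma K_Units: "k \<in> K \<Longrightarrow> k \<in> Units R"
  using subgroup.mem_carrier[OF K_subgroup] by (simp add: units_of_carrier)

lemma K_carrier [simp]: "k \<in> K \<Longrightarrow> k \<in> carrier R"
  using K_Units Units_closed by blast

lemma K_mult: "k \<in> K \<Longrightarrow> l \<in> K \<Longrightarrow> k \<otimes> l \<in> K"
  using subgroup.m_closed[OF K_subgroup] by (simp add: units_of_mult)

lemma K_one: "\<one> \<in> K"
  using subgroup.one_closed[OF K_subgroup] by (simp add: units_of_one)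

lemma K_inv: "k \<in> K \<Longrightarrow> inv k \<in> K"
  using subgroup.m_inv_closed[OF K_subgroup] K_Units by (simp add: units_of_inv)

sublocale I: ideal I R by (rule I_ideal)

text \<open>As \<open>I\<close> lies in \<open>M\<close>, it squares to zero, so
  \<open>(1 + a) (1 + b) = 1 + (a + b)\<close> and products in \<open>K\<close> become sums in
  \<open>J\<close>. A principal ideal inside \<open>J\<close> is zero by purity of
  \<open>K\<close>.\<close>

sublocale slope_system R M I J
proof (intro slope_system.intro slope_system_axioms.intro)
  show "finite_local_ring R M" ..
  show "x \<otimes> v = \<zero>" if "v \<in> I" "x \<in> M" for v x using I_M that .
  show "J \<subseteq> I" by (auto simp: J_def)
  have "additive_subgroup J R"
  proof (rule additive_subgroup_finiteI[OF finite_carrier])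
    show "J \<subseteq> carrier R" using I.Icarr by (auto simp: J_def)
    show "\<zero> \<in> J" using K_one by (simp add: J_def)
    fix a b assume ab: "a \<in> J" "b \<in> J"
    then have c: "a \<in> carrier R" "b \<in> carrier R" "a \<in> I" "b \<in> I" by (auto simp: J_def I.Icarr)
    have "a \<otimes> b = \<zero>" using I_M I_subset c by blast
    then have "(\<one> \<oplus> a) \<otimes> (\<one> \<oplus> b) = \<one> \<oplus> (a \<oplus> b)"
      using c by (simp add: l_distr r_distr a_ac)
    then show "a \<oplus> b \<in> J" using ab K_mult[of "\<one> \<oplus> a" "\<one> \<oplus> b"] by (simp add: J_def)
  qed
  then show "additive_subgroup J R" .
  show "v = \<zero>" if v: "v \<in> I" and J: "\<And>r. r \<in> carrier R \<Longrightarrow> r \<otimes> v \<in> J" for v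
  proof -
    have vc: "v \<in> carrier R" using v by (rule I.Icarr)
    have "(\<lambda>x. \<one> \<oplus> x) ` (PIdl v) \<subseteq> K"
      using J by (auto simp: cgenideal_def J_def)
    then have "PIdl v = {\<zero>}"
      using K_pure cgenideal_ideal[OF vc] unfolding pure_group_def by blast
    then show ?thesis using cgenideal_self[OF vc] by simp
  qed
qed (rule I_ideal)

text \<open>The criterion of \<open>cyc_aut_iff\<close>, convenient for translated and rescaled
  automorphisms.\<close>

definition cyc_map :: "('a \<Rightarrow> 'a) \<Rightarrow> bool" where
  "cyc_map f \<longleftrightarrow> f \<in> carrier R \<rightarrow> carrier R \<and>
    (\<forall>x \<in> carrier R. \<forall>y \<in> carrier R. \<exists>k \<in> K. f y \<ominus> f x = (y \<ominus> x) \<otimes> k)"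

lemma cyc_aut_iff_cyc_map: "f \<in> cyc_aut R K \<longleftrightarrow> cyc_map f"
  unfolding cyc_map_def
  by (rule cyc_aut_iff[OF finite_carrier _ K_one K_mult]) (auto intro: K_Units)

lemma cyc_map_bij: "cyc_map f \<Longrightarrow> bij_betw f (carrier R) (carrier R)"
  by (simp add: cyc_aut_def flip: cyc_aut_iff_cyc_map)

lemma cyc_map_closed: "cyc_map f \<Longrightarrow> x \<in> carrier R \<Longrightarrow> f x \<in> carrier R"
  by (auto simp: cyc_map_def)

lemma cyc_map_inj: "cyc_map f \<Longrightarrow> x \<in> carrier R \<Longrightarrow> y \<in> carrier R \<Longrightarrow> f x = f y \<Longrightarrow> x = y"
  by (meson bij_betw_imp_inj_on cyc_map_bij inj_onD)

lemma cyc_map_diff: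
  assumes "cyc_map f" "x \<in> carrier R" "y \<in> carrier R"
  obtains k where "k \<in> K" "f y \<ominus> f x = (y \<ominus> x) \<otimes> k"
proof -
  have "\<exists>k \<in> K. f y \<ominus> f x = (y \<ominus> x) \<otimes> k"
    using assms(1) unfolding cyc_map_def by (metis assms(2,3))
  then show ?thesis using that by (elim bexE)
qed

text \<open>An automorphism changes each difference by a unit factor only.\<close>

lemma cyc_map_diff_I_iff:
  assumes f: "cyc_map f" and [simp]: "x \<in> carrier R" "y \<in> carrier R"
  shows "f y \<ominus> f x \<in> I \<longleftrightarrow> y \<ominus> x \<in> I"
proof -
  obtain k where k: "k \<in> K" "f y \<ominus> f x = (y \<ominus> x) \<otimes> k"
    using cyc_map_diff[OF f, of x y] by auto
  show ?thesis
  proof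
    assume "f y \<ominus> f x \<in> I"
    then have "(y \<ominus> x) \<otimes> k \<otimes> inv k \<in> I"
      using k K_inv by (simp add: I.I_r_closed)
    then show "y \<ominus> x \<in> I" using k(1) K_Units K_inv by (simp add: m_assoc)
  qed (use k in \<open>simp add: I.I_r_closed\<close>)
qed

section \<open>Passage to the quotient scheme\<close>

lemma cyc_aut_quotient:
  assumes f: "cyc_map f"
  obtains F where "F \<in> cyc_aut (R Quot I) ((+>) I ` K)" "\<And>x. x \<in> carrier R \<Longrightarrow> F (I +> x) = I +> f x"
proof -
  let ?Q = "R Quot I"
  have cQ: "carrier ?Q = (+>) I ` carrier R" by (auto simp: FactRing_def A_RCOSETS_def')
  interpret h: ring_hom_ring R ?Q "(+>) I" by (rule I.rcos_ring_hom_ring)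
  interpret Q: cring ?Q by (rule I.quotient_is_cring[OF is_cring])
  have hminus: "I +> (x \<ominus> y) = (I +> x) \<ominus>\<^bsub>?Q\<^esub> (I +> y)" if "x \<in> carrier R" "y \<in> carrier R" for x y
    using that by (simp add: a_minus_def)
  \<comment> \<open>The union avoids choosing representatives: by \<open>cyc_map_diff_I_iff\<close>
    all its members coincide when \<open>A\<close> is a coset.\<close>
  define F where "F A = (\<Union>x\<in>A. I +> f x)" for A
  have F: "F (I +> x) = I +> f x" if x: "x \<in> carrier R" for x
  proof -
    have "I +> f y = I +> f x" if y: "y \<in> I +> x" for y
    proof -
      have yc: "y \<in> carrier R" using y x I.a_elemrcos_carrier by blast
      have "y \<ominus> x \<in> I" using y x yc I.a_rcos_module_minus[OF ring_axioms] by blast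
      then have "f y \<ominus> f x \<in> I" using cyc_map_diff_I_iff[OF f] x yc by simp
      then show ?thesis
        using quotient_eq_iff_same_a_r_cos[OF I_ideal] cyc_map_closed[OF f] x yc by blast
    qed
    moreover have "x \<in> I +> x" by (rule I.a_rcos_self[OF x])
    ultimately show ?thesis unfolding F_def by blast
  qed
  have "F \<in> cyc_aut ?Q ((+>) I ` K)"
  proof (subst Q.cyc_aut_iff)
    show "finite (carrier ?Q)" using cQ finite_carrier by simp
    show "(+>) I ` K \<subseteq> Units ?Q"
    proof clarify
      fix k assume k: "k \<in> K"
      have "(I +> k) \<otimes>\<^bsub>?Q\<^esub> (I +> inv k) = \<one>\<^bsub>?Q\<^esub>"
        using k K_inv K_Units by (simp flip: h.hom_mult h.hom_one)
      moreover have "I +> k \<in> carrier ?Q" "I +> inv k \<in> carrier ?Q"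
        using k K_inv by simp_all
      moreover have "(I +> inv k) \<otimes>\<^bsub>?Q\<^esub> (I +> k) = \<one>\<^bsub>?Q\<^esub>"
        using calculation Q.m_comm by simp
      ultimately show "I +> k \<in> Units ?Q" unfolding Units_def by blast
    qed
    show "\<one>\<^bsub>?Q\<^esub> \<in> (+>) I ` K" using imageI[OF K_one, of "(+>) I"] by simp
    show "k \<otimes>\<^bsub>?Q\<^esub> l \<in> (+>) I ` K" if kl: "k \<in> (+>) I ` K" "l \<in> (+>) I ` K" for k l
    proof -
      obtain a b where "a \<in> K" "b \<in> K" "k = I +> a" "l = I +> b" using kl by blast
      moreover from this have "k \<otimes>\<^bsub>?Q\<^esub> l = I +> a \<otimes> b" by simp
      ultimately show ?thesis by (metis K_mult imageI)
    qed
    have "F \<in> carrier ?Q \<rightarrow> carrier ?Q"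
    proof
      fix A assume "A \<in> carrier ?Q"
      then obtain x where "x \<in> carrier R" "A = I +> x" unfolding cQ by blast
      then show "F A \<in> carrier ?Q" using F cyc_map_closed[OF f] by simp
    qed
    moreover have "\<exists>k \<in> (+>) I ` K. F B \<ominus>\<^bsub>?Q\<^esub> F A = (B \<ominus>\<^bsub>?Q\<^esub> A) \<otimes>\<^bsub>?Q\<^esub> k"
      if AB: "A \<in> carrier ?Q" "B \<in> carrier ?Q" for A B
    proof -
      obtain x y where xy: "x \<in> carrier R" "A = I +> x" "y \<in> carrier R" "B = I +> y"
        using AB unfolding cQ by blast
      obtain k where k: "k \<in> K" "f y \<ominus> f x = (y \<ominus> x) \<otimes> k"
        using cyc_map_diff[OF f xy(1,3)] .
      have "F B \<ominus>\<^bsub>?Q\<^esub> F A = I +> (f y \<ominus> f x)"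
        using xy F hminus cyc_map_closed[OF f] by simp
      also have "\<dots> = (B \<ominus>\<^bsub>?Q\<^esub> A) \<otimes>\<^bsub>?Q\<^esub> (I +> k)"
        using k xy hminus by simp
      finally show ?thesis using k(1) by blast
    qed
    ultimately show "F \<in> carrier ?Q \<rightarrow> carrier ?Q \<and> (\<forall>A \<in> carrier ?Q. \<forall>B \<in> carrier ?Q.
      \<exists>k \<in> (+>) I ` K. F B \<ominus>\<^bsub>?Q\<^esub> F A = (B \<ominus>\<^bsub>?Q\<^esub> A) \<otimes>\<^bsub>?Q\<^esub> k)" by blast
  qed
  then show ?thesis using that F by blast
qed

text \<open>By normality the induced permutation has the form \<open>A -> a s A + b\<close> with a
  ring automorphism \<open>s\<close>. Fixing \<open>0\<close> and \<open>1\<close> forces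
  \<open>b = 0\<close> and \<open>a = 1\<close>, so \<open>f\<close> induces
  \<open>s\<close>.\<close>

lemma cyc_map_hom_mod:
  assumes normal: "cyc_normal (R Quot I) ((+>) I ` K)"
    and f: "cyc_map f" "f \<zero> = \<zero>" "f \<one> = \<one>" and x: "x \<in> carrier R" and y: "y \<in> carrier R"
  shows "f (x \<oplus> y) \<ominus> (f x \<oplus> f y) \<in> I" "f (x \<otimes> y) \<ominus> f x \<otimes> f y \<in> I"
proof -
  let ?Q = "R Quot I"
  interpret h: ring_hom_ring R ?Q "(+>) I" by (rule I.rcos_ring_hom_ring)
  interpret Q: cring ?Q by (rule I.quotient_is_cring[OF is_cring])
  obtain F where F: "F \<in> cyc_aut ?Q ((+>) I ` K)" "\<And>x. x \<in> carrier R \<Longrightarrow> F (I +> x) = I +> f x"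
    using cyc_aut_quotient[OF f(1)] by blast
  obtain g where "g \<in> AGammaL1 ?Q" and Fg: "\<forall>A \<in> carrier ?Q. F A = g A"
    using bspec[OF normal[unfolded cyc_normal_def] F(1)] by (elim bexE)
  then obtain a b s where ab: "a \<in> Units ?Q" "b \<in> carrier ?Q" and s: "s \<in> ring_iso ?Q ?Q"
    and gs: "\<forall>A \<in> carrier ?Q. g A = a \<otimes>\<^bsub>?Q\<^esub> s A \<oplus>\<^bsub>?Q\<^esub> b"
    unfolding AGammaL1_def by (elim CollectE bexE)
  have eq: "F A = a \<otimes>\<^bsub>?Q\<^esub> s A \<oplus>\<^bsub>?Q\<^esub> b" if "A \<in> carrier ?Q" for A
    using bspec[OF Fg that] bspec[OF gs that] by (rule trans)
  interpret s: ring_hom_ring ?Q ?Q s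
    using s by (intro ring_hom_ringI2) (auto simp: ring_iso_def h.S.ring_axioms)
  have "F \<zero>\<^bsub>?Q\<^esub> = \<zero>\<^bsub>?Q\<^esub>" "F \<one>\<^bsub>?Q\<^esub> = \<one>\<^bsub>?Q\<^esub>"
    using F(2)[of \<zero>] F(2)[of \<one>] f by simp_all
  moreover have "a \<in> carrier ?Q" using ab(1) by (simp add: Units_def)
  ultimately have "b = \<zero>\<^bsub>?Q\<^esub>" "a = \<one>\<^bsub>?Q\<^esub>"
    using eq[of "\<zero>\<^bsub>?Q\<^esub>"] eq[of "\<one>\<^bsub>?Q\<^esub>"] ab(2) by simp_all
  then have Fs: "I +> f x = s (I +> x)" if "x \<in> carrier R" for x
    using eq[of "I +> x"] that F(2) by simp
  note [simp] = cyc_map_closed[OF f(1)]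
  have "I +> f (x \<oplus> y) = I +> (f x \<oplus> f y)" "I +> f (x \<otimes> y) = I +> f x \<otimes> f y"
    using x y by (simp_all add: Fs)
  then show "f (x \<oplus> y) \<ominus> (f x \<oplus> f y) \<in> I" "f (x \<otimes> y) \<ominus> f x \<otimes> f y \<in> I"
    using quotient_eq_iff_same_a_r_cos[OF I_ideal] x y by simp_all
qed

text \<open>The map \<open>h = f^-1 g\<close> multiplies each difference by an element
  \<open>k\<close> of \<open>K\<close>. Hence \<open>d x = h x - x\<close> has slopes
  \<open>k - 1\<close>, which lie in \<open>J\<close> because \<open>d\<close> is
  \<open>I\<close>-valued. By \<open>slope_map_affine\<close> and \<open>d 0 = 0\<close>,
  \<open>d x = x j\<close>.\<close>

lemma cyc_map_congruent:
  assumes f: "cyc_map f" "f \<zero> = \<zero>" and g: "cyc_map g" "g \<zero> = \<zero>"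
    and fg: "\<And>x. x \<in> carrier R \<Longrightarrow> g x \<ominus> f x \<in> I"
  shows "\<exists>j \<in> J. \<forall>x \<in> carrier R. g x = f (x \<oplus> x \<otimes> j)"
proof -
  note [simp] = cyc_map_closed[OF f(1)] cyc_map_closed[OF g(1)]
  define h where "h x = inv_into (carrier R) f (g x)" for x
  have img: "f ` carrier R = carrier R"
    using cyc_map_bij[OF f(1)] by (simp add: bij_betw_def)
  have h [simp]: "h x \<in> carrier R" and fh: "f (h x) = g x" if "x \<in> carrier R" for x
    using that img cyc_map_closed[OF g(1)] inv_into_into[of "g x" f "carrier R"]
      f_inv_into_f[of "g x" f "carrier R"] by (auto simp: h_def)
  have hI: "h x \<ominus> x \<in> I" if "x \<in> carrier R" for x
    using cyc_map_diff_I_iff[OF f(1), of x "h x"] that fh fg by simp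
  have h_diff: "\<exists>k \<in> K. h x \<ominus> h z = (x \<ominus> z) \<otimes> k" if x: "x \<in> carrier R" and z: "z \<in> carrier R" for x z
  proof -
    obtain k where k: "k \<in> K" "g x \<ominus> g z = (x \<ominus> z) \<otimes> k" using cyc_map_diff[OF g(1) z x] .
    obtain l where l: "l \<in> K" "f (h x) \<ominus> f (h z) = (h x \<ominus> h z) \<otimes> l"
      using cyc_map_diff[OF f(1), of "h z" "h x"] x z by auto
    have il: "inv l \<in> carrier R" "l \<in> Units R" using K_inv[OF l(1)] K_Units[OF l(1)] by simp_all
    have "(h x \<ominus> h z) \<otimes> l = (x \<ominus> z) \<otimes> k" using k(2) l(2) x z by (simp add: fh)
    then have "(h x \<ominus> h z) \<otimes> l \<otimes> inv l = (x \<ominus> z) \<otimes> k \<otimes> inv l" by simp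
    then have "h x \<ominus> h z = (x \<ominus> z) \<otimes> (k \<otimes> inv l)"
      using l(1) k(1) il x z by (simp add: m_assoc)
    then show ?thesis using K_mult[OF k(1) K_inv[OF l(1)]] by blast
  qed
  define d where "d x = h x \<ominus> x" for x
  have dc [simp]: "d x \<in> carrier R" if "x \<in> carrier R" for x using that by (simp add: d_def)
  have "slope_map d"
    unfolding slope_map_def
  proof (intro conjI ballI impI)
    show "d \<in> carrier R \<rightarrow> I" using hI by (simp add: d_def)
    fix x z assume x: "x \<in> carrier R" and z: "z \<in> carrier R" and u: "x \<ominus> z \<in> Units R"
    define w where "w = inv (x \<ominus> z)"
    have w: "w \<in> carrier R" "w \<otimes> (x \<ominus> z) = \<one>" using u by (simp_all add: w_def)
    obtain k where k: "k \<in> K" "h x \<ominus> h z = (x \<ominus> z) \<otimes> k" using h_diff[OF x z] by blast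
    have "w \<otimes> (h x \<ominus> h z) = k"
      unfolding k(2) using k(1) x z w by (simp flip: m_assoc)
    moreover have "d x \<ominus> d z = (h x \<ominus> h z) \<ominus> (x \<ominus> z)"
      using x z by (simp add: d_def minus_eq minus_add a_ac)
    ultimately have eq: "w \<otimes> (d x \<ominus> d z) = k \<ominus> \<one>"
      using w x z by (simp add: minus_eq[of "h x \<ominus> h z"] minus_eq[of k] r_distr r_minus)
    have "\<one> \<oplus> (k \<ominus> \<one>) = k" using k(1) by (simp add: add_minus_cancel)
    moreover have "w \<otimes> (d x \<ominus> d z) \<in> I"
      using w(1) hI x z by (intro I.I_l_closed) (simp_all add: d_def)
    ultimately show "inv (x \<ominus> z) \<otimes> (d x \<ominus> d z) \<in> J"
      using k(1) eq unfolding w_def[symmetric] by (simp add: J_def)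
  qed
  then obtain j where j: "j \<in> J" "\<And>x. x \<in> carrier R \<Longrightarrow> d x = d \<zero> \<oplus> x \<otimes> j"
    using slope_map_affine unfolding affine_map_def by blast
  have "h \<zero> = \<zero>"
    using cyc_map_inj[OF f(1), of "h \<zero>" \<zero>] fh[of \<zero>] f(2) g(2) by simp
  then have d0: "d \<zero> = \<zero>" by (simp add: d_def)
  have "g x = f (x \<oplus> x \<otimes> j)" if x: "x \<in> carrier R" for x
  proof -
    have "h x \<ominus> x = x \<otimes> j" using j(2)[OF x] d0 j(1) x by (simp add: d_def)
    then have "h x = x \<oplus> x \<otimes> j" using x j(1) by (simp add: minus_eq_iff a_ac)
    then show ?thesis using fh[OF x] by simp
  qed
  then show ?thesis using j(1) by blast
qed

section \<open>Automorphisms fixing \<open>0\<close> and \<open>1\<close>, and the reduction to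
  them\<close>

lemma mult_J_M: "x \<in> M \<Longrightarrow> j \<in> J \<Longrightarrow> x \<otimes> j = \<zero>"
  using I_M J_subset by blast

lemma mult_J_in_M: "x \<in> carrier R \<Longrightarrow> j \<in> J \<Longrightarrow> x \<otimes> j \<in> M"
  using J_subset I_subset I.I_l_closed by blast

lemma normalized_cyc_map_iso:
  assumes normal: "cyc_normal (R Quot I) ((+>) I ` K)"
    and f: "cyc_map f" "f \<zero> = \<zero>" "f \<one> = \<one>"
  shows "f \<in> ring_iso R R"
proof -
  note [simp] = cyc_map_closed[OF f(1)]
  note hom_mod = cyc_map_hom_mod[OF normal f]
  have "\<exists>j \<in> J. \<forall>x \<in> carrier R. f (x \<oplus> y) \<ominus> f y = f (x \<oplus> x \<otimes> j)" if y: "y \<in> carrier R" for y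
  proof (rule cyc_map_congruent[OF f(1,2)])
    show "cyc_map (\<lambda>x. f (x \<oplus> y) \<ominus> f y)"
      unfolding cyc_map_def
    proof (intro conjI ballI)
      fix x z assume x: "x \<in> carrier R" and z: "z \<in> carrier R"
      have "(z \<oplus> y) \<ominus> (x \<oplus> y) = z \<ominus> x"
        using x y z by (simp add: minus_eq_iff) (simp add: minus_eq a_ac add_minus_cancel r_neg r_neg1 r_neg2)
      moreover have "(f (z \<oplus> y) \<ominus> f y) \<ominus> (f (x \<oplus> y) \<ominus> f y) = f (z \<oplus> y) \<ominus> f (x \<oplus> y)"
        using x y z by (simp add: minus_eq minus_add a_ac add_minus_cancel r_neg1 r_neg2)
      ultimately show "\<exists>k\<in>K. (f (z \<oplus> y) \<ominus> f y) \<ominus> (f (x \<oplus> y) \<ominus> f y) = (z \<ominus> x) \<otimes> k"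
        using cyc_map_diff[OF f(1), of "x \<oplus> y" "z \<oplus> y"] x y z by (metis a_closed)
    qed (use y in auto)
    show "f (\<zero> \<oplus> y) \<ominus> f y = \<zero>" using y by (simp add: minus_eq r_neg)
    show "f (x \<oplus> y) \<ominus> f y \<ominus> f x \<in> I" if "x \<in> carrier R" for x
      using hom_mod(1)[OF that y] that y by (simp add: minus_eq minus_add a_ac)
  qed
  then obtain a where aJ: "\<And>y. y \<in> carrier R \<Longrightarrow> a y \<in> J"
    and a: "\<And>x y. x \<in> carrier R \<Longrightarrow> y \<in> carrier R \<Longrightarrow> f (x \<oplus> y) \<ominus> f y = f (x \<oplus> x \<otimes> a y)"
    by metis
  have add_M: "f (x \<oplus> y) = f x \<oplus> f y" if x: "x \<in> M" and y: "y \<in> carrier R" for x y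
    using a[OF M.Icarr[OF x] y] mult_J_M[OF x aJ[OF y]] M.Icarr[OF x] y by (simp add: minus_eq_iff)
  have add_a: "f (x \<oplus> y) = f x \<oplus> f y \<oplus> f (x \<otimes> a y)" if x: "x \<in> carrier R" and y: "y \<in> carrier R" for x y
  proof -
    have c: "x \<otimes> a y \<in> carrier R" using x aJ[OF y] by simp
    have "f (x \<oplus> x \<otimes> a y) = f (x \<otimes> a y \<oplus> x)" using x c by (simp add: a_comm)
    also have "\<dots> = f (x \<otimes> a y) \<oplus> f x" by (rule add_M[OF mult_J_in_M[OF x aJ[OF y]] x])
    finally show ?thesis using a[OF x y] x y c by (simp add: minus_eq_iff a_ac)
  qed
  have swap: "x \<otimes> a y = y \<otimes> a x" if x: "x \<in> carrier R" and y: "y \<in> carrier R" for x y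
  proof -
    have c: "x \<otimes> a y \<in> carrier R" "y \<otimes> a x \<in> carrier R" using x y aJ by simp_all
    have "f x \<oplus> f y \<oplus> f (x \<otimes> a y) = f x \<oplus> f y \<oplus> f (y \<otimes> a x)"
      using add_a[OF x y] add_a[OF y x] x y c by (simp add: a_ac)
    then have "f (x \<otimes> a y) = f (y \<otimes> a x)" using x y c by simp
    then show ?thesis using cyc_map_inj[OF f(1) c] by simp
  qed
  have a1: "y \<otimes> a \<one> = a y" if "y \<in> carrier R" for y
    using swap[OF that one_closed] aJ[OF that] by simp
  have "a \<one> = \<zero>"
    by (rule pure) (use aJ J_subset a1 in auto)
  then have "a y = \<zero>" if "y \<in> carrier R" for y using a1[OF that] that by simp
  then have add: "f (x \<oplus> y) = f x \<oplus> f y" if "x \<in> carrier R" "y \<in> carrier R" for x y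
    using add_a[OF that] that f(2) by simp
  have mult_U: "f (u \<otimes> x) = f u \<otimes> f x" if u: "u \<in> Units R" and x: "x \<in> carrier R" for u x
  proof -
    have uc: "u \<in> carrier R" using u by (rule Units_closed)
    obtain k where k: "k \<in> K" "f u \<ominus> f \<zero> = (u \<ominus> \<zero>) \<otimes> k"
      using cyc_map_diff[OF f(1) zero_closed uc] .
    then have fu: "f u = u \<otimes> k" using uc f(2) by (simp add: minus_eq)
    then have fuU: "f u \<in> Units R" using u K_Units[OF k(1)] by simp
    have inv_fu: "inv (f u) = inv u \<otimes> inv k" unfolding fu using u K_Units[OF k(1)] by (rule Units_inv_mult)
    have "\<exists>j \<in> J. \<forall>x \<in> carrier R. inv (f u) \<otimes> f (u \<otimes> x) = f (x \<oplus> x \<otimes> j)"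
    proof (rule cyc_map_congruent[OF f(1,2)])
      show "cyc_map (\<lambda>x. inv (f u) \<otimes> f (u \<otimes> x))"
        unfolding cyc_map_def
      proof (intro conjI ballI)
        fix x z assume x: "x \<in> carrier R" and z: "z \<in> carrier R"
        obtain l where l: "l \<in> K" "f (u \<otimes> z) \<ominus> f (u \<otimes> x) = (u \<otimes> z \<ominus> u \<otimes> x) \<otimes> l"
          using cyc_map_diff[OF f(1), of "u \<otimes> x" "u \<otimes> z"] uc x z by auto
        have "inv (f u) \<otimes> f (u \<otimes> z) \<ominus> inv (f u) \<otimes> f (u \<otimes> x)
          = inv (f u) \<otimes> (f (u \<otimes> z) \<ominus> f (u \<otimes> x))"
          using fuU uc x z by (simp add: minus_eq r_distr r_minus)
        also have "\<dots> = inv u \<otimes> inv k \<otimes> (u \<otimes> (z \<ominus> x) \<otimes> l)"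
          unfolding l(2) inv_fu using uc x z by (simp add: minus_eq r_distr r_minus)
        also have "\<dots> = inv u \<otimes> (u \<otimes> ((z \<ominus> x) \<otimes> (inv k \<otimes> l)))"
          using uc u x z l(1) K_inv[OF k(1)] by (simp add: m_ac)
        also have "\<dots> = (z \<ominus> x) \<otimes> (inv k \<otimes> l)"
          using u x z l(1) K_inv[OF k(1)] by (simp add: Units_cancel)
        finally show "\<exists>k\<in>K. inv (f u) \<otimes> f (u \<otimes> z) \<ominus> inv (f u) \<otimes> f (u \<otimes> x) = (z \<ominus> x) \<otimes> k"
          using K_mult[OF K_inv[OF k(1)] l(1)] by blast
      qed (use fuU uc in auto)
      show "inv (f u) \<otimes> f (u \<otimes> \<zero>) = \<zero>" using fuU uc f(2) by simp
      show "inv (f u) \<otimes> f (u \<otimes> x) \<ominus> f x \<in> I" if x: "x \<in> carrier R" for x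
      proof -
        have "inv (f u) \<otimes> f (u \<otimes> x) \<ominus> f x = inv (f u) \<otimes> (f (u \<otimes> x) \<ominus> f u \<otimes> f x)"
          using fuU uc x by (simp add: minus_eq r_distr r_minus Units_cancel)
        then show ?thesis using hom_mod(2)[OF uc x] fuU by (simp add: I.I_l_closed)
      qed
    qed
    then obtain j where j: "j \<in> J"
      "\<And>x. x \<in> carrier R \<Longrightarrow> inv (f u) \<otimes> f (u \<otimes> x) = f (x \<oplus> x \<otimes> j)" by blast
    have "\<one> = \<one> \<oplus> f j"
      using j(2)[of \<one>] j(1) add[of \<one> j] fuU uc f(3) by simp
    then have "f j = \<zero>" using j(1) by simp
    then have j0: "j = \<zero>" using cyc_map_inj[OF f(1), of j \<zero>] j(1) f(2) by simp
    have "inv (f u) \<otimes> f (u \<otimes> x) = f x" unfolding j(2)[OF x] j0 using x by simp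
    then have "f u \<otimes> (inv (f u) \<otimes> f (u \<otimes> x)) = f u \<otimes> f x" by (rule arg_cong)
    moreover have "f u \<otimes> (inv (f u) \<otimes> f (u \<otimes> x)) = f (u \<otimes> x)"
      by (rule Units_cancel(1)[OF fuU]) (use uc x in simp)
    ultimately show ?thesis by metis
  qed
  have mult: "f (r \<otimes> x) = f r \<otimes> f x" if r: "r \<in> carrier R" and x: "x \<in> carrier R" for r x
  proof (cases "r \<in> Units R")
    case True
    then show ?thesis using x by (rule mult_U)
  next
    case False
    then have "\<one> \<oplus> r \<in> Units R" using Units_add_M Units_or_M r by blast
    then have "f ((\<one> \<oplus> r) \<otimes> x) = f (\<one> \<oplus> r) \<otimes> f x" using x by (rule mult_U)
    then show ?thesis using r x f(3) by (simp add: l_distr add)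
  qed
  show ?thesis
    unfolding ring_iso_def using cyc_map_bij[OF f(1)] mult add f(3)
    by (intro CollectI conjI ring_hom_memI) simp_all
qed

theorem cyc_normal_if_quotient_normal:
  assumes normal: "cyc_normal (R Quot I) ((+>) I ` K)"
  shows "cyc_normal R K"
proof -
  have "f \<in> AGammaL1 R" if "f \<in> cyc_aut R K" for f
  proof -
    have f: "cyc_map f" using that by (simp add: cyc_aut_iff_cyc_map)
    note [simp] = cyc_map_closed[OF f]
    obtain k where k: "k \<in> K" "f \<one> \<ominus> f \<zero> = (\<one> \<ominus> \<zero>) \<otimes> k"
      using cyc_map_diff[OF f zero_closed one_closed] .
    then have k1: "f \<one> \<ominus> f \<zero> = k" by (simp add: minus_eq)
    define g where "g x = inv k \<otimes> (f x \<ominus> f \<zero>)" for x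
    have ik [simp]: "inv k \<in> carrier R" using K_inv[OF k(1)] by simp
    have g: "cyc_map g"
      unfolding cyc_map_def
    proof (intro conjI ballI)
      show "g \<in> carrier R \<rightarrow> carrier R" by (auto simp: g_def)
      fix x y assume x: "x \<in> carrier R" and y: "y \<in> carrier R"
      obtain l where l: "l \<in> K" "f y \<ominus> f x = (y \<ominus> x) \<otimes> l" using cyc_map_diff[OF f x y] .
      have "f y \<ominus> f \<zero> \<ominus> (f x \<ominus> f \<zero>) = f y \<ominus> f x"
        using x y by (simp add: minus_eq minus_add a_ac add_minus_cancel r_neg1 r_neg2)
      then have "g y \<ominus> g x = inv k \<otimes> (f y \<ominus> f x)"
        using x y unfolding g_def by (metis (no_types, lifting) a_minus_def r_distr r_minus minus_closed
          a_inv_closed ik cyc_map_closed[OF f] zero_closed)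
      also have "\<dots> = (y \<ominus> x) \<otimes> (inv k \<otimes> l)" unfolding l(2) using l(1) x y by (simp add: m_ac)
      finally show "\<exists>k\<in>K. g y \<ominus> g x = (y \<ominus> x) \<otimes> k" using K_mult[OF K_inv[OF k(1)] l(1)] by blast
    qed
    moreover have "g \<zero> = \<zero>" by (simp add: g_def minus_eq r_neg)
    moreover have "g \<one> = \<one>" using K_Units[OF k(1)] by (simp add: g_def k1)
    ultimately have "g \<in> ring_iso R R" by (rule normalized_cyc_map_iso[OF normal])
    moreover have eq: "f x = k \<otimes> g x \<oplus> f \<zero>" if x: "x \<in> carrier R" for x
      using x K_Units[OF k(1)] by (simp add: g_def Units_cancel) (simp add: minus_eq a_ac r_neg r_neg1 add_minus_cancel r_neg2)
    ultimately show ?thesis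
      unfolding AGammaL1_def using K_Units[OF k(1)] cyc_map_closed[OF f zero_closed] by blast
  qed
  then show ?thesis
    unfolding cyc_normal_def by blast
qed

end

theorem theorem1p8:
  fixes R :: "('a, 'b) ring_scheme" and K :: "'a set"
  assumes "local_ring R"
    and "finite (carrier R)"
    and "subgroup K (units_of R)"
    and "pure_group R K"
    and "cyc_normal (R Quot (I0 R)) ((\<lambda>k. (I0 R) +>\<^bsub>R\<^esub> k) ` K)"
  shows "cyc_normal R K"
proof -
  interpret finite_local_ring R "rad R"
    by (rule local_ring_finite_local_ring[OF assms(1,2)])
  have I0: "I0 R = {x \<in> rad R. \<forall>y \<in> rad R. x \<otimes>\<^bsub>R\<^esub> y = \<zero>\<^bsub>R\<^esub>}"
    unfolding I0_def using M.zero_closed by auto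
  have "ideal (I0 R) R"
  proof (rule idealI[OF ring_axioms])
    have "additive_subgroup (I0 R) R"
      by (rule additive_subgroup_finiteI[OF finite_carrier])
        (auto simp: I0 M.Icarr l_distr)
    then show "subgroup (I0 R) (add_monoid R)" by (rule additive_subgroup.a_subgroup)
    fix a x assume a: "a \<in> I0 R" and x: "x \<in> carrier R"
    have "a \<otimes>\<^bsub>R\<^esub> x \<in> I0 R"
      using a x unfolding I0 by (auto simp: M.I_r_closed M.Icarr m_assoc M.I_l_closed)
    then show "a \<otimes>\<^bsub>R\<^esub> x \<in> I0 R" "x \<otimes>\<^bsub>R\<^esub> a \<in> I0 R"
      using a x m_comm[of a x] by (simp_all add: I0 M.Icarr)
  qed
  then interpret pure_cyclotomic R "rad R" "I0 R" K
    by (intro pure_cyclotomic.intro pure_cyclotomic_axioms.intro finite_local_ring_axioms)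
      (auto simp: I0 assms M.Icarr m_comm)
  show ?thesis by (rule cyc_normal_if_quotient_normal) (rule assms(5))
qed

end
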